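(* Let $n\ge 2$ and let $\mathbb{M}^n=(\mathbb{R}^n,\|\cdot\|)$ be a Minkowski space. For $D\in[1/j(\mathbb{M}^n),2]$ let $$r_D:=\min\{r(K):K\in\mathcal{K}^n,\ R(K)=1,\ D(K)=D\}.$$ (i) For every $D\in[1/j(\mathbb{M}^n),2]$ there exists $S\in\mathcal{K}^n$ which is either subdimensional (i.e. $\dim(S)\le n-1$) or a simplex, such that $R(S)=1$, $D(S)=D$ and $r(S)=r_D$. (ii) The set of points $\{(r_D,D/2):D\in[1/j(\mathbb{M}^n),2]\}$ is non-increasing, i.e. if $1/j(\mathbb{M}^n)\le D_1<D_2\le 2$, then $r_{D_2}\le r_{D_1}$.
   Context: $\mathcal{K}^n$ denotes the set of convex bodies in $\mathbb{R}^n$, i.e. non-empty, convex, compact sets (possibly with empty interior). A Minkowski space is $\mathbb{R}^n$ with a norm $\|\cdot\|$; its unit ball is $\mathbb{B}=\{x:\|x\|\le 1\}$. For $K\in\mathcal{K}^n$: circumradius $R(K)=\inf\{\rho\ge 0:K\subset c+\rho\mathbb{B},\ c\in\mathbb{R}^n\}$; inradius $r(K)=\sup\{\rho\ge 0: c+\rho\mathbb{B}\subset K,\ c\in\mathbb{R}^n\}$; diameter $D(K)=\max_{x,y\in K}\|x-y\|$. The Jung constant is $j(\mathbb{M}^n)=\max\{R(K)/D(K):K\in\mathcal{K}^n,\ K\text{ not a single point}\}$. A simplex here is the convex hull of $n+1$ affinely independent points. *)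

theory Defs
  imports "HOL-Analysis.Analysis"
begin

text \<open>
  A Minkowski space is \<open>real ^ 'n\<close> together with an arbitrary norm \<open>N\<close>, which in general differs
  from the Euclidean \<open>norm\<close> of the type. Compactness refers to the usual topology of
  \<open>real ^ 'n\<close>, which is the one induced by every such \<open>N\<close>.
\<close>

definition is_norm :: "(real ^ 'n \<Rightarrow> real) \<Rightarrow> bool" where
  "is_norm N \<longleftrightarrow>
     (\<forall>x. 0 \<le> N x) \<and>
     (\<forall>x. N x = 0 \<longleftrightarrow> x = 0) \<and>
     (\<forall>a x. N (a *\<^sub>R x) = \<bar>a\<bar> * N x) \<and>
     (\<forall>x y. N (x + y) \<le> N x + N y)"

definition unit_ball :: "(real ^ 'n \<Rightarrow> real) \<Rightarrow> (real ^ 'n) set" where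
  "unit_ball N = {x. N x \<le> 1}"

definition convex_body :: "(real ^ 'n) set \<Rightarrow> bool" where
  "convex_body K \<longleftrightarrow> K \<noteq> {} \<and> convex K \<and> compact K"

definition circumradius :: "(real ^ 'n \<Rightarrow> real) \<Rightarrow> (real ^ 'n) set \<Rightarrow> real" where
  "circumradius N K = Inf {\<rho>. 0 \<le> \<rho> \<and> (\<exists>c. K \<subseteq> (\<lambda>x. c + \<rho> *\<^sub>R x) ` unit_ball N)}"

definition inradius :: "(real ^ 'n \<Rightarrow> real) \<Rightarrow> (real ^ 'n) set \<Rightarrow> real" where
  "inradius N K = Sup {\<rho>. 0 \<le> \<rho> \<and> (\<exists>c. (\<lambda>x. c + \<rho> *\<^sub>R x) ` unit_ball N \<subseteq> K)}"

text \<open>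
  The maxima and the minimum below are taken over infinite sets of reals and are written as
  \<open>Sup\<close> and \<open>Inf\<close>. For a norm \<open>N\<close> all these sets are nonempty and bounded on the relevant side
  (in \<open>min_inradius\<close>, for \<open>D\<close> between \<open>1 / jung_constant N\<close> and \<open>2\<close>), so each value is the
  maximum or minimum as soon as it is attained.
\<close>

definition diam :: "(real ^ 'n \<Rightarrow> real) \<Rightarrow> (real ^ 'n) set \<Rightarrow> real" where
  "diam N K = Sup {N (x - y) | x y. x \<in> K \<and> y \<in> K}"

definition jung_constant :: "(real ^ 'n \<Rightarrow> real) \<Rightarrow> real" where
  "jung_constant N =
     Sup {circumradius N K / diam N K | K. convex_body K \<and> \<not> is_singleton K}"

definition min_inradius :: "(real ^ 'n \<Rightarrow> real) \<Rightarrow> real \<Rightarrow> real" where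
  "min_inradius N D =
     Inf {inradius N K | K. convex_body K \<and> circumradius N K = 1 \<and> diam N K = D}"

end

theory Submission
  imports Defs
begin

text \<open>
  By Helly's theorem every convex body contains \<open>n + 1\<close> points whose convex hull has the same
  circumradius; diameter and inradius do not grow when passing to this hull. So, by compactness,
  it remains to enlarge the diameter of the hull \<open>T\<close> of \<open>n + 1\<close> points up to the prescribed
  value without decreasing \<open>R\<close> and without increasing \<open>r\<close>, both up to a common scaling.

  If \<open>T\<close> lies in a hyperplane, then \<open>r = 0\<close>, and one deforms \<open>T\<close> linearly into a segment inside
  that hyperplane. Otherwise only one vertex \<open>q\<close> is moved. As a function of \<open>q\<close>, on one side of
  the opposite facet, \<open>r\<close> is quasiconcave, hence it does not exceed its value at \<open>q\<close> on a whole
  hyperplane through \<open>q\<close>. On the other hand \<open>R\<close> is convex in \<open>q\<close>, so on each line through \<open>q\<close>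
  it is nondecreasing in one of the two directions. As \<open>n \<ge> 2\<close>, the hyperplane contains such
  a direction; far away the simplex looks like a segment, for which \<open>D = 2 R\<close>, and the
  intermediate value theorem yields the prescribed diameter, unless the vertex first reaches
  the hyperplane of the facet, where the flat case applies.
\<close>

subsection \<open>Convex hulls of point configurations\<close>

text \<open>Points are indexed by a finite type, with repetitions allowed, so that configurations
  form a Euclidean space in which compactness and continuity apply. The index type
  \<open>'n option\<close> gives \<open>n + 1\<close> points.\<close>

definition cfg_hull :: "(real ^ 'n) ^ 'm \<Rightarrow> (real ^ 'n) set" where
  "cfg_hull P = convex hull (range (($) P))"

lemma cfg_hull_nth: "P $ i \<in> cfg_hull P"
  unfolding cfg_hull_def by (intro hull_inc) auto

lemma convex_cfg_hull: "convex (cfg_hull P)"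
  and compact_cfg_hull: "compact (cfg_hull P)"
  and cfg_hull_nonempty: "cfg_hull P \<noteq> {}"
  unfolding cfg_hull_def by (auto intro: finite_imp_compact_convex_hull)

lemma bounded_cfg_hull: "bounded (cfg_hull P)"
  by (simp add: compact_cfg_hull compact_imp_bounded)

lemma convex_body_cfg_hull: "convex_body (cfg_hull P)"
  by (simp add: convex_body_def convex_cfg_hull compact_cfg_hull cfg_hull_nonempty)

lemma cfg_hull_subset: "convex S \<Longrightarrow> (\<And>i. P $ i \<in> S) \<Longrightarrow> cfg_hull P \<subseteq> S"
  unfolding cfg_hull_def by (intro hull_minimal) auto

lemma cfg_hull_affinity:
  "cfg_hull (\<chi> i. a + s *\<^sub>R P $ i) = (\<lambda>x. a + s *\<^sub>R x) ` cfg_hull P"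
proof -
  have "range (($) (\<chi> i. a + s *\<^sub>R P $ i)) = (\<lambda>x. a + s *\<^sub>R x) ` range (($) P)"
    by auto
  then show ?thesis by (simp add: cfg_hull_def convex_hull_affinity)
qed

text \<open>Full affine dimension \<open>n\<close> forces the at most \<open>n + 1\<close> points to
  be exactly \<open>n + 1\<close> and affinely independent.\<close>

lemma cfg_hull_dichotomy:
  fixes P :: "(real ^ 'n) ^ 'n option"
  shows "aff_dim (cfg_hull P) \<le> int CARD('n) - 1 \<or> int CARD('n) simplex cfg_hull P"
proof (rule disjCI)
  let ?A = "range (($) P)"
  assume "\<not> int CARD('n) simplex cfg_hull P"
  moreover have "card ?A \<le> CARD('n) + 1"
    using card_image_le[of UNIV "($) P"] by simp
  moreover have "aff_dim ?A \<le> int (card ?A) - 1" "aff_dim ?A \<le> int CARD('n)"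
    using aff_dim_le_card[of ?A] aff_dim_le_DIM[of ?A] by auto
  ultimately show "aff_dim (cfg_hull P) \<le> int CARD('n) - 1"
    unfolding simplex_def cfg_hull_def affine_independent_iff_card aff_dim_convex_hull
    by (smt (verit) finite finite_imageI of_nat_1 of_nat_add of_nat_le_iff)
qed

lemma exists_cfg_range:
  fixes Y :: "(real ^ 'n) set"
  assumes "finite Y" "Y \<noteq> {}" "card Y \<le> CARD('m)"
  shows "\<exists>P :: (real ^ 'n) ^ 'm. range (($) P) = Y"
proof -
  obtain f :: "real ^ 'n \<Rightarrow> 'm" where f: "inj_on f Y"
    using card_le_inj[of Y "UNIV :: 'm set"] assms by auto
  obtain y0 where y0: "y0 \<in> Y" using assms(2) by blast
  \<comment> \<open>Surplus indices all receive \<open>y0\<close>, so sets with fewer than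
    \<open>CARD('m)\<close> points are covered.\<close>
  define P :: "(real ^ 'n) ^ 'm" where
    "P = (\<chi> i. if i \<in> f ` Y then inv_into Y f i else y0)"
  have "P $ f y = y" if "y \<in> Y" for y using that f by (simp add: P_def)
  then have "Y \<subseteq> range (($) P)" by (metis rangeI subsetI)
  moreover have "range (($) P) \<subseteq> Y"
    using y0 by (auto simp: P_def inv_into_into)
  ultimately show ?thesis by blast
qed

section \<open>Configurations with a movable apex, stored at the index \<open>None\<close>\<close>

definition set_apex :: "(real ^ 'n) ^ ('m :: finite) option \<Rightarrow> real ^ 'n \<Rightarrow> (real ^ 'n) ^ 'm option" where
  "set_apex P x = (\<chi> i. if i = None then x else P $ i)"

definition cfg_base :: "(real ^ 'n) ^ ('m :: finite) option \<Rightarrow> (real ^ 'n) set" where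
  "cfg_base P = convex hull (range (\<lambda>i. P $ Some i))"

lemma set_apex_same: "set_apex P (P $ None) = P"
  by (simp add: set_apex_def vec_eq_iff)

lemma set_apex_nth [simp]: "set_apex P x $ None = x" "set_apex P x $ Some i = P $ Some i"
  by (simp_all add: set_apex_def)

text \<open>Affine dependence on the apex carries convexity in the configuration over to convexity
  in the apex alone.\<close>

lemma set_apex_combine:
  assumes "u + v = 1"
  shows "set_apex P (u *\<^sub>R x + v *\<^sub>R y) = u *\<^sub>R set_apex P x + v *\<^sub>R set_apex P y"
proof -
  have "u *\<^sub>R P $ i + v *\<^sub>R P $ i = P $ i" for i
    using assms by (simp flip: scaleR_add_left)
  then show ?thesis by (simp add: set_apex_def vec_eq_iff[of "vec_lambda _"])
qed

lemma cfg_hull_set_apex: "cfg_hull (set_apex P x) = convex hull (insert x (cfg_base P))"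
proof -
  have "range (($) (set_apex P x)) = insert x (range (\<lambda>i. P $ Some i))"
    by (simp add: UNIV_option_conv image_image)
  then show ?thesis by (simp add: cfg_hull_def cfg_base_def flip: hull_insert)
qed

lemma continuous_on_set_apex: "continuous_on S (set_apex P)"
proof -
  have "continuous_on S (\<lambda>x. \<chi> i. if i = None then x else P $ i)"
  proof (rule continuous_on_vec_lambda)
    show "continuous_on S (\<lambda>x. if i = None then x else P $ i)" for i
      by (cases i) simp_all
  qed
  then show ?thesis unfolding set_apex_def .
qed

text \<open>The \<open>n\<close> base points always lie in a hyperplane; since the whole
  configuration does not, the apex is off it, and the sign of the normal can be chosen.\<close>

lemma full_cfg_apex:
  fixes P :: "(real ^ 'n) ^ 'n option"
  assumes "\<not> (\<exists>u c. u \<noteq> 0 \<and> (\<forall>i. u \<bullet> P $ i = c))"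
  obtains \<eta> c where "\<eta> \<noteq> 0" "cfg_base P \<subseteq> {x. \<eta> \<bullet> x = c}" "c < \<eta> \<bullet> P $ None"
proof -
  let ?B = "range (\<lambda>i. P $ Some i)"
  have "card ?B \<le> CARD('n)" by (rule card_image_le) simp
  then have "aff_dim ?B < DIM(real ^ 'n)"
    using aff_dim_le_card[of ?B] by simp
  then obtain u c where u: "u \<noteq> 0" "?B \<subseteq> {x. u \<bullet> x = c}"
    by (rule aff_lowdim_subset_hyperplane)
  then have B: "cfg_base P \<subseteq> {x. u \<bullet> x = c}"
    unfolding cfg_base_def by (intro hull_minimal convex_hyperplane)
  have "u \<bullet> P $ None \<noteq> c"
  proof
    assume "u \<bullet> P $ None = c"
    then have "u \<bullet> P $ i = c" for i using u(2) by (cases i) auto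
    then show False using assms u(1) by blast
  qed
  then consider "c < u \<bullet> P $ None" | "- c < - u \<bullet> P $ None" by fastforce
  then show ?thesis
  proof cases
    case 1 then show ?thesis using that u B by blast
  next
    case 2 then show ?thesis using that[of "- u" "- c"] u B by auto
  qed
qed

lemma compact_cfgs:
  fixes K :: "(real ^ 'n) set"
  assumes "compact K"
  shows "compact {P :: (real ^ 'n) ^ ('m :: finite). \<forall>i. P $ i \<in> K}"
proof -
  obtain B where B: "\<And>x. x \<in> K \<Longrightarrow> norm x \<le> B"
    using compact_imp_bounded[OF assms] by (auto simp: bounded_iff)
  have "norm P \<le> of_nat CARD('m) * B" if "\<forall>i. P $ i \<in> K" for P :: "(real ^ 'n) ^ 'm"
  proof -
    have "norm P \<le> (\<Sum>i\<in>UNIV. norm (P $ i))"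
      unfolding norm_vec_def by (rule L2_set_le_sum) simp
    also have "\<dots> \<le> of_nat CARD('m) * B"
      using that B by (intro sum_bounded_above) auto
    finally show ?thesis .
  qed
  then have "bounded {P :: (real ^ 'n) ^ 'm. \<forall>i. P $ i \<in> K}"
    by (auto simp: bounded_iff)
  moreover have "closed {P :: (real ^ 'n) ^ 'm. \<forall>i. P $ i \<in> K}"
  proof (rule closed_Collect_all)
    fix i :: 'm
    have "closed ((\<lambda>P :: (real ^ 'n) ^ 'm. P $ i) -` K)"
      using compact_imp_closed[OF assms] by (intro closed_vimage continuous_intros) auto
    then show "closed {P :: (real ^ 'n) ^ 'm. P $ i \<in> K}" by (simp add: vimage_def)
  qed
  ultimately show ?thesis by (simp add: compact_eq_bounded_closed)
qed

locale minkowski =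
  fixes N :: "real ^ 'n \<Rightarrow> real"
  assumes is_norm: "is_norm N"
begin

subsection \<open>The norm\<close>

lemma N_nonneg [simp]: "0 \<le> N x"
  and N_eq_0_iff [simp]: "N x = 0 \<longleftrightarrow> x = 0"
  and N_scaleR: "N (a *\<^sub>R x) = \<bar>a\<bar> * N x"
  and N_triangle: "N (x + y) \<le> N x + N y"
  using is_norm by (auto simp: is_norm_def)

lemma N_zero [simp]: "N 0 = 0"
  by simp

lemma N_minus: "N (- x) = N x"
  using N_scaleR[of "-1" x] by simp

lemma N_minus_commute: "N (x - y) = N (y - x)"
  using N_minus[of "x - y"] by simp

lemma N_triangle_sub: "N (x - z) \<le> N (x - y) + N (y - z)"
  using N_triangle[of "x - y" "y - z"] by simp

text \<open>A norm is convex, and a finite convex function on all of a Euclidean space is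
  continuous.\<close>

lemma continuous_on_N: "continuous_on S N"
proof -
  have "convex_on UNIV N"
  proof (rule convex_onI)
    fix t :: real and x y assume "0 < t" "t < 1"
    then show "N ((1 - t) *\<^sub>R x + t *\<^sub>R y) \<le> (1 - t) * N x + t * N y"
      using N_triangle[of "(1 - t) *\<^sub>R x" "t *\<^sub>R y"] by (simp add: N_scaleR)
  qed simp
  then have "continuous_on UNIV N"
    by (intro convex_on_continuous) auto
  then show ?thesis
    by (rule continuous_on_subset) simp
qed

lemma continuous_on_N_comp [continuous_intros]:
  "continuous_on S f \<Longrightarrow> continuous_on S (\<lambda>x. N (f x))"
  using continuous_on_compose2[OF continuous_on_N[of UNIV]] by blast

text \<open>The constants are the minimum and the maximum of \<open>N\<close> on the Euclidean unit
  sphere; homogeneity extends the bounds to all vectors.\<close>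

lemma N_equiv_norm:
  obtains c C where "0 < c" "0 < C" "\<And>x. c * norm x \<le> N x" "\<And>x. N x \<le> C * norm x"
proof -
  have ne: "sphere (0 :: real ^ 'n) 1 \<noteq> {}" and co: "compact (sphere (0 :: real ^ 'n) 1)"
    by auto
  obtain a where a: "a \<in> sphere 0 1" "\<And>x. x \<in> sphere 0 1 \<Longrightarrow> N a \<le> N x"
    using continuous_attains_inf[OF co ne continuous_on_N] by blast
  obtain b where b: "b \<in> sphere 0 1" "\<And>x. x \<in> sphere 0 1 \<Longrightarrow> N x \<le> N b"
    using continuous_attains_sup[OF co ne continuous_on_N] by blast
  have eq: "N x = norm x * N (x /\<^sub>R norm x)" if "x \<noteq> 0" for x
    using that by (simp add: N_scaleR)
  have pos: "0 < N z" if "z \<in> sphere 0 1" for z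
    using that N_nonneg[of z] by (auto simp: less_le)
  show ?thesis
  proof (rule that[of "N a" "N b"])
    fix x :: "real ^ 'n"
    show "N a * norm x \<le> N x"
    proof (cases "x = 0")
      case False
      then have "N a * norm x \<le> N (x /\<^sub>R norm x) * norm x"
        by (intro mult_right_mono a) auto
      then show ?thesis using eq[OF False] by (simp add: mult.commute)
    qed simp
    show "N x \<le> N b * norm x"
    proof (cases "x = 0")
      case False
      then have "N (x /\<^sub>R norm x) * norm x \<le> N b * norm x"
        by (intro mult_right_mono b) auto
      then show ?thesis using eq[OF False] by (simp add: mult.commute)
    qed simp
  qed (use a b pos in auto)
qed

lemma N_bounded:
  assumes "bounded K"
  obtains M where "0 \<le> M" "\<And>x. x \<in> K \<Longrightarrow> N x \<le> M"
proof -
  obtain c C where C: "0 < c" "0 < C" "\<And>x. c * norm x \<le> N x" "\<And>x. N x \<le> C * norm x"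
    using N_equiv_norm by blast
  obtain B where B: "0 < B" "\<And>x. x \<in> K \<Longrightarrow> norm x \<le> B"
    using assms by (auto simp: bounded_pos)
  show ?thesis
  proof (rule that[of "C * B"])
    show "N x \<le> C * B" if "x \<in> K" for x
      using C(4)[of x] B(2)[OF that] C(2) by (meson mult_left_mono order.trans less_imp_le)
  qed (use B C in auto)
qed

abbreviation nball :: "real ^ 'n \<Rightarrow> real \<Rightarrow> (real ^ 'n) set" where
  "nball c \<rho> \<equiv> {x. N (x - c) \<le> \<rho>}"

lemma compact_nball: "compact (nball c \<rho>)"
proof -
  obtain k C where k: "0 < k" "0 < C" "\<And>x. k * norm x \<le> N x" "\<And>x. N x \<le> C * norm x"
    using N_equiv_norm by blast
  have "nball c \<rho> \<subseteq> cball c (\<rho> / k)"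
  proof
    fix x assume "x \<in> nball c \<rho>"
    then have "k * norm (x - c) \<le> \<rho>"
      using k(3)[of "x - c"] by simp
    then show "x \<in> cball c (\<rho> / k)"
      using k(1) by (simp add: dist_norm norm_minus_commute field_simps)
  qed
  moreover have "closed (nball c \<rho>)"
    by (intro closed_Collect_le continuous_intros)
  ultimately show ?thesis
    using bounded_subset[OF bounded_cball] compact_eq_bounded_closed by blast
qed

lemma convex_nball: "convex (nball c \<rho>)"
proof (rule convexI)
  fix x y and u v :: real
  assume *: "x \<in> nball c \<rho>" "y \<in> nball c \<rho>" "0 \<le> u" "0 \<le> v" "u + v = 1"
  have "u *\<^sub>R x + v *\<^sub>R y - c = u *\<^sub>R (x - c) + v *\<^sub>R (y - c)"
    using * by (simp add: algebra_simps flip: scaleR_add_left)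
  then have "N (u *\<^sub>R x + v *\<^sub>R y - c) \<le> u * N (x - c) + v * N (y - c)"
    using N_triangle[of "u *\<^sub>R (x - c)" "v *\<^sub>R (y - c)"] * by (simp add: N_scaleR)
  also have "\<dots> \<le> \<rho>"
    using * by (intro convex_bound_le) auto
  finally show "u *\<^sub>R x + v *\<^sub>R y \<in> nball c \<rho>" by simp
qed

lemma scaled_unit_ball:
  assumes "0 \<le> \<rho>"
  shows "(\<lambda>x. c + \<rho> *\<^sub>R x) ` unit_ball N = nball c \<rho>"
proof (cases "\<rho> = 0")
  case True
  have "unit_ball N \<noteq> {}"
    by (auto simp: unit_ball_def intro!: exI[of _ 0])
  moreover have "N x \<le> 0 \<longleftrightarrow> x = 0" for x
    using N_nonneg[of x] N_eq_0_iff[of x] by linarith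
  ultimately show ?thesis using True by auto
next
  case False
  then have \<rho>: "0 < \<rho>" using assms by simp
  show ?thesis
  proof (intro subset_antisym subsetI)
    fix x assume x: "x \<in> nball c \<rho>"
    show "x \<in> (\<lambda>x. c + \<rho> *\<^sub>R x) ` unit_ball N"
    proof
      show "x = c + \<rho> *\<^sub>R ((x - c) /\<^sub>R \<rho>)" using \<rho> by simp
      show "(x - c) /\<^sub>R \<rho> \<in> unit_ball N"
        using x \<rho> by (simp only: unit_ball_def N_scaleR mem_Collect_eq) (simp add: field_simps)
    qed
  next
    fix x assume "x \<in> (\<lambda>x. c + \<rho> *\<^sub>R x) ` unit_ball N"
    then show "x \<in> nball c \<rho>"
      using \<rho> by (auto simp: unit_ball_def N_scaleR mult_left_le)
  qed
qed

subsection \<open>Circumradius, diameter and inradius\<close>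

lemma circumradius_eq:
  "circumradius N K = Inf {\<rho>. 0 \<le> \<rho> \<and> (\<exists>c. K \<subseteq> nball c \<rho>)}"
  unfolding circumradius_def by (intro arg_cong[where f = Inf] Collect_cong conj_cong refl)
    (simp add: scaled_unit_ball)

lemma inradius_eq:
  "inradius N K = Sup {\<rho>. 0 \<le> \<rho> \<and> (\<exists>c. nball c \<rho> \<subseteq> K)}"
  unfolding inradius_def by (intro arg_cong[where f = Sup] Collect_cong conj_cong refl)
    (simp add: scaled_unit_ball)

lemma circumradius_le:
  assumes "0 \<le> \<rho>" "K \<subseteq> nball c \<rho>"
  shows "circumradius N K \<le> \<rho>"
  unfolding circumradius_eq using assms by (intro cInf_lower bdd_belowI[of _ 0]) auto

lemma circumradius_set_nonempty:
  assumes "bounded K"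
  shows "{\<rho>. 0 \<le> \<rho> \<and> (\<exists>c. K \<subseteq> nball c \<rho>)} \<noteq> {}"
proof -
  obtain M where "0 \<le> M" "\<And>x. x \<in> K \<Longrightarrow> N x \<le> M"
    using N_bounded[OF assms] by blast
  then have "0 \<le> M \<and> K \<subseteq> nball 0 M" by auto
  then show ?thesis by blast
qed

text \<open>Works without attainment of the infimum: every strictly larger radius has a
  centre.\<close>

lemma circumradius_less:
  assumes "bounded K" "circumradius N K < \<rho>"
  obtains c where "K \<subseteq> nball c \<rho>"
proof -
  obtain \<sigma> c where "\<sigma> < \<rho>" "K \<subseteq> nball c \<sigma>"
    using cInf_lessD[OF circumradius_set_nonempty[OF assms(1)]] assms(2)
    unfolding circumradius_eq by blast
  then show ?thesis by (intro that[of c]) force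
qed

lemma circumradius_nonneg: "bounded K \<Longrightarrow> 0 \<le> circumradius N K"
  unfolding circumradius_eq by (intro cInf_greatest circumradius_set_nonempty) auto

lemma diam_bdd_above:
  assumes "bounded K"
  shows "bdd_above {N (x - y) | x y. x \<in> K \<and> y \<in> K}"
proof -
  obtain M where M: "\<And>x. x \<in> K \<Longrightarrow> N x \<le> M"
    using N_bounded[OF assms] by blast
  have "N (x - y) \<le> M + M" if "x \<in> K" "y \<in> K" for x y
    using N_triangle[of x "- y"] M[of x] M[of y] that by (simp add: N_minus)
  then show ?thesis by (intro bdd_aboveI[of _ "M + M"]) auto
qed

lemma N_diff_le_diam:
  assumes "bounded K" "x \<in> K" "y \<in> K"
  shows "N (x - y) \<le> diam N K"
  unfolding diam_def using assms by (intro cSup_upper diam_bdd_above) auto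

lemma diam_le:
  assumes "K \<noteq> {}" "\<And>x y. x \<in> K \<Longrightarrow> y \<in> K \<Longrightarrow> N (x - y) \<le> d"
  shows "diam N K \<le> d"
  unfolding diam_def using assms by (intro cSup_least) (auto, blast)

lemma diam_mono:
  assumes "bounded L" "K \<noteq> {}" "K \<subseteq> L"
  shows "diam N K \<le> diam N L"
  using assms by (intro diam_le N_diff_le_diam) auto

lemma exists_unit: obtains u where "N u = 1"
proof -
  obtain w :: "real ^ 'n" where "w \<noteq> 0"
    using SOME_Basis nonzero_Basis by blast
  then show ?thesis
    by (intro that[of "w /\<^sub>R N w"]) (simp add: N_scaleR)
qed

lemma inradius_bdd_above:
  assumes "bounded K"
  shows "bdd_above {\<rho>. 0 \<le> \<rho> \<and> (\<exists>c. nball c \<rho> \<subseteq> K)}"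
proof -
  obtain u where u: "N u = 1" by (rule exists_unit)
  obtain M where M: "\<And>x. x \<in> K \<Longrightarrow> N x \<le> M"
    using N_bounded[OF assms] by blast
  \<comment> \<open>The ball contains its centre and a point at \<open>N\<close>-distance \<rho>
    from it, and both have norm at most \<open>M\<close>.\<close>
  have "\<rho> \<le> M + M" if \<rho>: "0 \<le> \<rho>" "nball c \<rho> \<subseteq> K" for \<rho> c
  proof -
    have "c + \<rho> *\<^sub>R u \<in> K" "c \<in> K"
      using \<rho> u by (auto simp: N_scaleR subset_iff)
    then have "N (c + \<rho> *\<^sub>R u) \<le> M" "N c \<le> M" using M by auto
    moreover have "\<rho> = N ((c + \<rho> *\<^sub>R u) + - c)" using u \<rho> by (simp add: N_scaleR)
    moreover have "N ((c + \<rho> *\<^sub>R u) + - c) \<le> N (c + \<rho> *\<^sub>R u) + N (- c)" by (rule N_triangle)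
    ultimately show ?thesis by (simp add: N_minus)
  qed
  then show ?thesis by (intro bdd_aboveI[of _ "M + M"]) auto
qed

lemma inradius_ge:
  assumes "bounded K" "0 \<le> \<rho>" "nball c \<rho> \<subseteq> K"
  shows "\<rho> \<le> inradius N K"
  unfolding inradius_eq using assms by (intro cSup_upper inradius_bdd_above) auto

lemma nball_zero: "nball c 0 = {c}"
proof -
  have "N x \<le> 0 \<longleftrightarrow> x = 0" for x
    using N_nonneg[of x] N_eq_0_iff[of x] by linarith
  then show ?thesis by auto
qed

lemma inradius_set_nonempty:
  assumes "K \<noteq> {}"
  shows "{\<rho>. 0 \<le> \<rho> \<and> (\<exists>c. nball c \<rho> \<subseteq> K)} \<noteq> {}"
proof -
  obtain x where "x \<in> K" using assms by blast
  then have "nball x 0 \<subseteq> K" by (simp add: nball_zero)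
  then have "(0::real) \<le> 0 \<and> (\<exists>c. nball c 0 \<subseteq> K)" by blast
  then show ?thesis by blast
qed

lemma inradius_nonneg:
  assumes "bounded K" "K \<noteq> {}"
  shows "0 \<le> inradius N K"
proof -
  obtain x where "x \<in> K" using assms by blast
  then show ?thesis using assms by (intro inradius_ge[of _ _ x]) (auto simp: nball_zero)
qed

lemma less_inradius:
  assumes "K \<noteq> {}" "a < inradius N K"
  obtains \<rho> c where "a < \<rho>" "0 \<le> \<rho>" "nball c \<rho> \<subseteq> K"
  using less_cSupD[OF inradius_set_nonempty[OF assms(1)]] assms(2)
  unfolding inradius_eq by blast

lemma inradius_le:
  assumes "K \<noteq> {}" "\<And>\<rho> c. 0 \<le> \<rho> \<Longrightarrow> nball c \<rho> \<subseteq> K \<Longrightarrow> \<rho> \<le> b"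
  shows "inradius N K \<le> b"
  unfolding inradius_eq using assms by (intro cSup_least inradius_set_nonempty) auto

lemma inradius_mono:
  assumes "bounded L" "K \<noteq> {}" "K \<subseteq> L"
  shows "inradius N K \<le> inradius N L"
  using assms by (intro inradius_le inradius_ge) auto

lemma diam_le_2_circumradius:
  assumes "bounded K" "K \<noteq> {}"
  shows "diam N K \<le> 2 * circumradius N K"
proof (rule field_le_epsilon)
  fix e :: real assume "0 < e"
  then obtain c where c: "K \<subseteq> nball c (circumradius N K + e / 2)"
    using circumradius_less[OF assms(1), of "circumradius N K + e / 2"] by auto
  show "diam N K \<le> 2 * circumradius N K + e"
  proof (rule diam_le[OF assms(2)])
    fix x y assume "x \<in> K" "y \<in> K"
    then have "N (x - c) \<le> circumradius N K + e / 2" "N (c - y) \<le> circumradius N K + e / 2"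
      using c N_minus_commute[of y c] by auto
    then show "N (x - y) \<le> 2 * circumradius N K + e"
      using N_triangle_sub[of x y c] by linarith
  qed
qed

section \<open>Stability of the three functionals under small perturbations\<close>

lemma circumradius_near:
  assumes "bounded L" "0 \<le> \<epsilon>" "\<And>x. x \<in> K \<Longrightarrow> \<exists>y\<in>L. N (x - y) \<le> \<epsilon>"
  shows "circumradius N K \<le> circumradius N L + \<epsilon>"
proof (rule field_le_epsilon)
  fix e :: real assume e: "0 < e"
  then obtain c where c: "L \<subseteq> nball c (circumradius N L + e)"
    using circumradius_less[OF assms(1), of "circumradius N L + e"] by auto
  show "circumradius N K \<le> circumradius N L + \<epsilon> + e"
  proof (rule circumradius_le[of _ _ c])
    show "0 \<le> circumradius N L + \<epsilon> + e"
      using e assms circumradius_nonneg[of L] by simp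
    show "K \<subseteq> nball c (circumradius N L + \<epsilon> + e)"
    proof
      fix x assume "x \<in> K"
      then obtain y where "y \<in> L" "N (x - y) \<le> \<epsilon>" using assms(3) by blast
      moreover from this have "N (y - c) \<le> circumradius N L + e" using c by blast
      ultimately have "N (x - c) \<le> circumradius N L + \<epsilon> + e"
        using N_triangle_sub[of x c y] by linarith
      then show "x \<in> nball c (circumradius N L + \<epsilon> + e)" by simp
    qed
  qed
qed

lemma circumradius_mono:
  assumes "bounded L" "K \<subseteq> L"
  shows "circumradius N K \<le> circumradius N L"
  using circumradius_near[OF assms(1), of 0 K] assms(2) by force

lemma diam_near:
  assumes "bounded L" "K \<noteq> {}" "\<And>x. x \<in> K \<Longrightarrow> \<exists>y\<in>L. N (x - y) \<le> \<epsilon>"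
  shows "diam N K \<le> diam N L + 2 * \<epsilon>"
proof (rule diam_le[OF assms(2)])
  fix x y assume "x \<in> K" "y \<in> K"
  then obtain x' y' where *: "x' \<in> L" "N (x - x') \<le> \<epsilon>" "y' \<in> L" "N (y - y') \<le> \<epsilon>"
    using assms(3) by meson
  then have "N (x' - y') \<le> diam N L" using N_diff_le_diam[OF assms(1)] by blast
  then show "N (x - y) \<le> diam N L + 2 * \<epsilon>"
    using * N_triangle_sub[of x y x'] N_triangle_sub[of x' y y'] N_minus_commute[of y y'] by linarith
qed

text \<open>
  This is the cancellation law for Minkowski sums: a ball of radius \<open>\<rho>\<close> in the
  \<open>\<epsilon>\<close>-neighbourhood of the convex set \<open>L\<close> can be shrunk to one of radius
  \<open>\<rho> - \<epsilon>\<close> in \<open>L\<close>.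
\<close>

lemma inradius_near:
  assumes "convex L" "compact L" "L \<noteq> {}" "K \<noteq> {}" "0 \<le> \<epsilon>"
    and near: "\<And>x. x \<in> K \<Longrightarrow> \<exists>y\<in>L. N (x - y) \<le> \<epsilon>"
  shows "inradius N K \<le> inradius N L + \<epsilon>"
proof (rule ccontr)
  assume "\<not> ?thesis"
  then obtain \<rho> c where \<rho>: "inradius N L + \<epsilon> < \<rho>" "nball c \<rho> \<subseteq> K"
    using less_inradius[OF assms(4), of "inradius N L + \<epsilon>"] by (metis not_le)
  have L: "bounded L" "closed L" using assms(2) by (auto simp: compact_imp_bounded compact_imp_closed)
  have "nball c (\<rho> - \<epsilon>) \<subseteq> L"
  proof (rule ccontr)
    assume "\<not> ?thesis"
    then obtain y where y: "N (y - c) \<le> \<rho> - \<epsilon>" "y \<notin> L" by auto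
    obtain a b where ab: "a \<bullet> y < b" "\<And>x. x \<in> L \<Longrightarrow> b < a \<bullet> x"
      using separating_hyperplane_closed_point[OF assms(1) L(2) y(2)] by blast
    have "nball 0 \<epsilon> \<noteq> {}" using assms(5) by (auto intro!: exI[of _ 0])
    \<comment> \<open>In direction \<open>a\<close>, \<open>w\<close> points as far away from
      \<open>L\<close> as the \<epsilon>-ball allows. The ball about \<open>c\<close> contains
      \<open>y + w\<close>, but a point \<open>l\<close> of \<open>L\<close> within \<epsilon> of it
      would satisfy \<open>a \<bullet> l \<le> a \<bullet> y\<close>.\<close>
    then obtain w where w: "N w \<le> \<epsilon>" "\<And>z. N z \<le> \<epsilon> \<Longrightarrow> a \<bullet> w \<le> a \<bullet> z"
      using continuous_attains_inf[OF compact_nball[of 0 \<epsilon>], of "\<lambda>z. a \<bullet> z"]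
      by (force intro!: continuous_intros)
    have "N (y + w - c) \<le> \<rho>"
      using N_triangle[of "y - c" w] y w by (simp add: algebra_simps)
    then obtain l where l: "l \<in> L" "N (y + w - l) \<le> \<epsilon>"
      using near \<rho>(2) by blast
    have "a \<bullet> w \<le> a \<bullet> (y + w - l)" using w(2)[OF l(2)] .
    then show False using ab(1) ab(2)[OF l(1)] by (simp add: inner_simps)
  qed
  moreover have "0 \<le> \<rho> - \<epsilon>"
    using \<rho>(1) inradius_nonneg[OF L(1) assms(3)] by simp
  ultimately show False
    using inradius_ge[OF L(1)] \<rho>(1) by fastforce
qed

section \<open>Behaviour under translation and scaling\<close>

lemma circumradius_affinity:
  assumes "bounded K" "0 < s"
  shows "circumradius N ((\<lambda>x. a + s *\<^sub>R x) ` K) = s * circumradius N K"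
proof -
  \<comment> \<open>The inverse of a homothety is again one, so this inequality for all homotheties
    also yields the reverse one.\<close>
  have le: "circumradius N ((\<lambda>x. a + s *\<^sub>R x) ` K) \<le> s * circumradius N K"
    if K: "bounded K" and s: "0 < s" for K a and s :: real
  proof (rule field_le_epsilon)
    fix e :: real assume e: "0 < e"
    then obtain c where c: "K \<subseteq> nball c (circumradius N K + e / s)"
      using circumradius_less[OF K, of "circumradius N K + e / s"] s by auto
    show "circumradius N ((\<lambda>x. a + s *\<^sub>R x) ` K) \<le> s * circumradius N K + e"
    proof (rule circumradius_le[of _ _ "a + s *\<^sub>R c"])
      show "0 \<le> s * circumradius N K + e" using e s circumradius_nonneg[OF K] by simp
      have "N (a + s *\<^sub>R x - (a + s *\<^sub>R c)) \<le> s * circumradius N K + e" if "x \<in> K" for x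
      proof -
        have "N (a + s *\<^sub>R x - (a + s *\<^sub>R c)) = s * N (x - c)"
          using s N_scaleR[of s "x - c"] by (simp add: scaleR_diff_right)
        also have "\<dots> \<le> s * (circumradius N K + e / s)"
          using c that s by (intro mult_left_mono) auto
        also have "\<dots> = s * circumradius N K + e"
          using s by (simp add: distrib_left)
        finally show ?thesis .
      qed
      then show "(\<lambda>x. a + s *\<^sub>R x) ` K \<subseteq> nball (a + s *\<^sub>R c) (s * circumradius N K + e)"
        by auto
    qed
  qed
  let ?L = "(\<lambda>x. a + s *\<^sub>R x) ` K"
  have "bounded ?L" using bounded_translation[OF bounded_scaling[OF assms(1)]]
    by (simp add: image_image)
  moreover have "(\<lambda>x. - (a /\<^sub>R s) + inverse s *\<^sub>R x) ` ?L = K"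
    using assms(2) by (simp add: image_image scaleR_add_right)
  ultimately have "circumradius N K \<le> inverse s * circumradius N ?L"
    using le[of ?L "inverse s" "- (a /\<^sub>R s)"] assms(2) by simp
  then show ?thesis
    using le[OF assms, of a] assms(2) by (simp add: field_simps)
qed

lemma diam_affinity:
  assumes "bounded K" "K \<noteq> {}" "0 < s"
  shows "diam N ((\<lambda>x. a + s *\<^sub>R x) ` K) = s * diam N K"
proof -
  have le: "diam N ((\<lambda>x. a + s *\<^sub>R x) ` K) \<le> s * diam N K"
    if K: "bounded K" "K \<noteq> {}" and s: "0 < s" for K a and s :: real
  proof (rule diam_le)
    fix x y assume "x \<in> (\<lambda>x. a + s *\<^sub>R x) ` K" "y \<in> (\<lambda>x. a + s *\<^sub>R x) ` K"
    then obtain x' y' where *: "x = a + s *\<^sub>R x'" "y = a + s *\<^sub>R y'" "x' \<in> K" "y' \<in> K" by auto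
    then have "N (x - y) = s * N (x' - y')"
      using s N_scaleR[of s "x' - y'"] by (simp add: scaleR_diff_right)
    also have "\<dots> \<le> s * diam N K"
      using N_diff_le_diam[OF K(1)] * s by simp
    finally show "N (x - y) \<le> s * diam N K" .
  qed (use K in auto)
  let ?L = "(\<lambda>x. a + s *\<^sub>R x) ` K"
  have "bounded ?L" using bounded_translation[OF bounded_scaling[OF assms(1)]]
    by (simp add: image_image)
  moreover have "(\<lambda>x. - (a /\<^sub>R s) + inverse s *\<^sub>R x) ` ?L = K"
    using assms(3) by (simp add: image_image scaleR_add_right)
  ultimately have "diam N K \<le> inverse s * diam N ?L"
    using le[of ?L "inverse s" "- (a /\<^sub>R s)"] assms by simp
  then show ?thesis
    using le[OF assms, of a] assms(3) by (simp add: field_simps)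
qed

lemma inradius_affinity:
  assumes "bounded K" "K \<noteq> {}" "0 < s"
  shows "inradius N ((\<lambda>x. a + s *\<^sub>R x) ` K) = s * inradius N K"
proof -
  have le: "s * inradius N K \<le> inradius N ((\<lambda>x. a + s *\<^sub>R x) ` K)"
    if K: "bounded K" "K \<noteq> {}" and s: "0 < s" for K a and s :: real
  proof -
    let ?L = "(\<lambda>x. a + s *\<^sub>R x) ` K"
    have bL: "bounded ?L" using bounded_translation[OF bounded_scaling[OF K(1)]]
      by (simp add: image_image)
    have "inradius N K \<le> inradius N ?L / s"
    proof (rule inradius_le[OF K(2)])
      fix \<rho> c assume \<rho>: "0 \<le> \<rho>" "nball c \<rho> \<subseteq> K"
      have "nball (a + s *\<^sub>R c) (s * \<rho>) \<subseteq> ?L"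
      proof
        fix x assume x: "x \<in> nball (a + s *\<^sub>R c) (s * \<rho>)"
        have "(x - a) /\<^sub>R s - c = (x - (a + s *\<^sub>R c)) /\<^sub>R s"
          using s by (simp add: algebra_simps)
        then have "N ((x - a) /\<^sub>R s - c) = inverse s * N (x - (a + s *\<^sub>R c))"
          using s by (simp only: N_scaleR) simp
        also have "\<dots> \<le> inverse s * (s * \<rho>)"
          using x s by (intro mult_left_mono) auto
        also have "\<dots> = \<rho>" using s by simp
        finally have "(x - a) /\<^sub>R s \<in> K" using \<rho>(2) by blast
        moreover have "x = a + s *\<^sub>R ((x - a) /\<^sub>R s)" using s by simp
        ultimately show "x \<in> ?L" by blast
      qed
      then have "s * \<rho> \<le> inradius N ?L" using bL \<rho>(1) s by (intro inradius_ge) auto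
      then show "\<rho> \<le> inradius N ?L / s" using s by (simp add: field_simps)
    qed
    then show ?thesis using s by (simp add: field_simps)
  qed
  let ?L = "(\<lambda>x. a + s *\<^sub>R x) ` K"
  have "bounded ?L" using bounded_translation[OF bounded_scaling[OF assms(1)]]
    by (simp add: image_image)
  moreover have "(\<lambda>x. - (a /\<^sub>R s) + inverse s *\<^sub>R x) ` ?L = K"
    using assms(3) by (simp add: image_image scaleR_add_right)
  ultimately have "inverse s * inradius N ?L \<le> inradius N K"
    using le[of ?L "inverse s" "- (a /\<^sub>R s)"] assms by simp
  then show ?thesis
    using le[OF assms, of a] assms(3) by (simp add: field_simps)
qed

text \<open>A ball of positive radius also extends in the direction of the normal \<open>u\<close>,
  so it leaves the hyperplane.\<close>

lemma inradius_flat: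
  assumes "bounded K" "K \<noteq> {}" "u \<noteq> 0" "K \<subseteq> {x. u \<bullet> x = c}"
  shows "inradius N K = 0"
proof -
  have "inradius N K \<le> 0"
  proof (rule inradius_le[OF assms(2)])
    fix \<rho> z assume \<rho>: "0 \<le> \<rho>" "nball z \<rho> \<subseteq> K"
    define w where "w = z + (\<rho> / N u) *\<^sub>R u"
    have "N (w - z) = \<rho>" using \<rho>(1) assms(3) by (simp add: w_def N_scaleR)
    then have "w \<in> K" "z \<in> K" using \<rho> by (auto simp: subset_iff)
    then have "u \<bullet> w = u \<bullet> z" using assms(4) by blast
    then have "\<rho> / N u * (u \<bullet> u) = 0" by (simp add: w_def inner_simps)
    then show "\<rho> \<le> 0" using assms(3) by simp
  qed
  then show ?thesis using inradius_nonneg[OF assms(1,2)] by simp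
qed

subsection \<open>Functionals of configurations\<close>

text \<open>The \<epsilon>-neighbourhood of a convex set is convex, so it contains the hull as soon
  as it contains the vertices.\<close>

lemma cfg_hull_near:
  assumes "\<And>i. N (P $ i - Q $ i) \<le> \<epsilon>" "x \<in> cfg_hull P"
  shows "\<exists>y\<in>cfg_hull Q. N (x - y) \<le> \<epsilon>"
proof -
  let ?S = "{x. \<exists>y\<in>cfg_hull Q. N (x - y) \<le> \<epsilon>}"
  have "cfg_hull P \<subseteq> ?S"
  proof (rule cfg_hull_subset)
    show "convex ?S"
    proof (rule convexI)
      fix x y and u v :: real
      assume uv: "0 \<le> u" "0 \<le> v" "u + v = 1" and "x \<in> ?S" "y \<in> ?S"
      then obtain x' y' where *: "x' \<in> cfg_hull Q" "N (x - x') \<le> \<epsilon>"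
        "y' \<in> cfg_hull Q" "N (y - y') \<le> \<epsilon>" by auto
      have "u *\<^sub>R x + v *\<^sub>R y - (u *\<^sub>R x' + v *\<^sub>R y') = u *\<^sub>R (x - x') + v *\<^sub>R (y - y')"
        by (simp add: algebra_simps)
      then have "N (u *\<^sub>R x + v *\<^sub>R y - (u *\<^sub>R x' + v *\<^sub>R y'))
          \<le> u * N (x - x') + v * N (y - y')"
        using N_triangle[of "u *\<^sub>R (x - x')" "v *\<^sub>R (y - y')"] uv by (simp add: N_scaleR)
      also have "\<dots> \<le> \<epsilon>" using * uv by (intro convex_bound_le) auto
      finally show "u *\<^sub>R x + v *\<^sub>R y \<in> ?S"
        using convexD[OF convex_cfg_hull *(1,3) uv] by blast
    qed
    show "P $ i \<in> ?S" for i using assms(1) cfg_hull_nth by blast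
  qed
  then show ?thesis using assms(2) by blast
qed

text \<open>The one-sided estimate, applied in both orders, makes \<open>f\<close> Lipschitz for the
  Euclidean distance; \<open>C\<close> comes from comparing the two norms.\<close>

lemma continuous_on_cfg:
  fixes f :: "(real ^ 'n) ^ 'm \<Rightarrow> real"
  assumes k: "0 \<le> k"
    and near: "\<And>P Q \<epsilon>. 0 \<le> \<epsilon> \<Longrightarrow> (\<And>i. N (P $ i - Q $ i) \<le> \<epsilon>) \<Longrightarrow> f P \<le> f Q + k * \<epsilon>"
  shows "continuous_on S f"
proof -
  obtain c C where C: "0 < c" "0 < C" "\<And>x. c * norm x \<le> N x" "\<And>x. N x \<le> C * norm x"
    using N_equiv_norm by blast
  have le: "f P \<le> f Q + k * C * dist P Q" for P Q
  proof -
    have "N (P $ i - Q $ i) \<le> C * dist P Q" for i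
    proof -
      have "C * norm ((P - Q) $ i) \<le> C * norm (P - Q)"
        using C(2) by (intro mult_left_mono Finite_Cartesian_Product.norm_nth_le) auto
      then show ?thesis
        using C(4)[of "(P - Q) $ i"] by (simp add: dist_norm)
    qed
    then have "f P \<le> f Q + k * (C * dist P Q)" using C(2) by (intro near) auto
    then show ?thesis by (simp add: mult.assoc)
  qed
  have "(k * C)-lipschitz_on UNIV f"
  proof (rule lipschitz_onI)
    show "dist (f P) (f Q) \<le> k * C * dist P Q" for P Q
      using le[of P Q] le[of Q P] by (simp add: dist_real_def dist_commute abs_le_iff)
  qed (use k C in auto)
  then show ?thesis
    using lipschitz_on_continuous_on continuous_on_subset by blast
qed

lemma continuous_on_circumradius:
  "continuous_on S (\<lambda>P :: (real ^ 'n) ^ 'm. circumradius N (cfg_hull P))"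
proof (rule continuous_on_cfg)
  fix P Q :: "(real ^ 'n) ^ 'm" and \<epsilon> :: real
  assume "0 \<le> \<epsilon>" "\<And>i. N (P $ i - Q $ i) \<le> \<epsilon>"
  then show "circumradius N (cfg_hull P) \<le> circumradius N (cfg_hull Q) + 1 * \<epsilon>"
    using circumradius_near[OF bounded_cfg_hull _ cfg_hull_near[of P Q \<epsilon>]] by simp
qed simp

lemma continuous_on_diam:
  "continuous_on S (\<lambda>P :: (real ^ 'n) ^ 'm. diam N (cfg_hull P))"
proof (rule continuous_on_cfg)
  fix P Q :: "(real ^ 'n) ^ 'm" and \<epsilon> :: real
  assume "0 \<le> \<epsilon>" "\<And>i. N (P $ i - Q $ i) \<le> \<epsilon>"
  then show "diam N (cfg_hull P) \<le> diam N (cfg_hull Q) + 2 * \<epsilon>"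
    using diam_near[OF bounded_cfg_hull cfg_hull_nonempty cfg_hull_near[of P Q \<epsilon>]] by simp
qed simp

lemma continuous_on_inradius:
  "continuous_on S (\<lambda>P :: (real ^ 'n) ^ 'm. inradius N (cfg_hull P))"
proof (rule continuous_on_cfg)
  fix P Q :: "(real ^ 'n) ^ 'm" and \<epsilon> :: real
  assume "0 \<le> \<epsilon>" "\<And>i. N (P $ i - Q $ i) \<le> \<epsilon>"
  then show "inradius N (cfg_hull P) \<le> inradius N (cfg_hull Q) + 1 * \<epsilon>"
    using inradius_near[OF convex_cfg_hull compact_cfg_hull cfg_hull_nonempty
        cfg_hull_nonempty _ cfg_hull_near[of P Q \<epsilon>]] by simp
qed simp

lemmas continuous_on_functionals [continuous_intros] =
  continuous_on_compose2[OF continuous_on_circumradius[of UNIV]]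
  continuous_on_compose2[OF continuous_on_diam[of UNIV]]
  continuous_on_compose2[OF continuous_on_inradius[of UNIV]]

lemma functionals_scale:
  assumes "0 < s"
  shows "circumradius N (cfg_hull (\<chi> i. a + s *\<^sub>R P $ i)) = s * circumradius N (cfg_hull P)"
    and "diam N (cfg_hull (\<chi> i. a + s *\<^sub>R P $ i)) = s * diam N (cfg_hull P)"
    and "inradius N (cfg_hull (\<chi> i. a + s *\<^sub>R P $ i)) = s * inradius N (cfg_hull P)"
  unfolding cfg_hull_affinity
  by (rule circumradius_affinity diam_affinity inradius_affinity
      bounded_cfg_hull cfg_hull_nonempty assms)+

text \<open>Passes from the scale-invariant quotients \<open>D/R\<close> and \<open>r/R\<close> back
  to hulls with \<open>R = 1\<close>.\<close>

lemma cfg_normalize: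
  fixes W :: "(real ^ 'n) ^ 'm"
  assumes "0 < circumradius N (cfg_hull W)"
  obtains Q :: "(real ^ 'n) ^ 'm" where "circumradius N (cfg_hull Q) = 1"
    "diam N (cfg_hull Q) = diam N (cfg_hull W) / circumradius N (cfg_hull W)"
    "inradius N (cfg_hull Q) = inradius N (cfg_hull W) / circumradius N (cfg_hull W)"
proof -
  let ?s = "inverse (circumradius N (cfg_hull W))"
  have "0 < ?s" using assms by simp
  note * = functionals_scale[OF this, of 0 W]
  show ?thesis
    using assms by (intro that[of "\<chi> i. 0 + ?s *\<^sub>R W $ i"]; subst *) (auto simp: divide_inverse)
qed

text \<open>If balls about \<open>a\<close> and \<open>b\<close> contain the two hulls, the same
  combination of centres and radii gives a ball containing the combined vertices. The excess
  \<open>e\<close> guarantees that centres exist.\<close>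

lemma circumradius_convex:
  fixes A B :: "(real ^ 'n) ^ 'm"
  assumes "0 \<le> u" "0 \<le> v" "u + v = 1"
  shows "circumradius N (cfg_hull (u *\<^sub>R A + v *\<^sub>R B))
    \<le> u * circumradius N (cfg_hull A) + v * circumradius N (cfg_hull B)"
proof (rule field_le_epsilon)
  fix e :: real assume e: "0 < e"
  define \<alpha> where "\<alpha> = circumradius N (cfg_hull A) + e"
  define \<beta> where "\<beta> = circumradius N (cfg_hull B) + e"
  obtain a where a: "cfg_hull A \<subseteq> nball a \<alpha>"
    using circumradius_less[OF bounded_cfg_hull, of A \<alpha>] e by (auto simp: \<alpha>_def)
  obtain b where b: "cfg_hull B \<subseteq> nball b \<beta>"
    using circumradius_less[OF bounded_cfg_hull, of B \<beta>] e by (auto simp: \<beta>_def)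
  have pos: "0 \<le> \<alpha>" "0 \<le> \<beta>"
    using e circumradius_nonneg[OF bounded_cfg_hull, of A]
      circumradius_nonneg[OF bounded_cfg_hull, of B] by (simp_all add: \<alpha>_def \<beta>_def)
  have "cfg_hull (u *\<^sub>R A + v *\<^sub>R B) \<subseteq> nball (u *\<^sub>R a + v *\<^sub>R b) (u * \<alpha> + v * \<beta>)"
  proof (rule cfg_hull_subset[OF convex_nball])
    fix i
    have "N (A $ i - a) \<le> \<alpha>" "N (B $ i - b) \<le> \<beta>"
      using a b cfg_hull_nth by blast+
    then have "u * N (A $ i - a) + v * N (B $ i - b) \<le> u * \<alpha> + v * \<beta>"
      using assms by (intro add_mono mult_left_mono) auto
    moreover have "(u *\<^sub>R A + v *\<^sub>R B) $ i - (u *\<^sub>R a + v *\<^sub>R b) = u *\<^sub>R (A $ i - a) + v *\<^sub>R (B $ i - b)"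
      by (simp add: algebra_simps)
    ultimately have "N ((u *\<^sub>R A + v *\<^sub>R B) $ i - (u *\<^sub>R a + v *\<^sub>R b)) \<le> u * \<alpha> + v * \<beta>"
      using N_triangle[of "u *\<^sub>R (A $ i - a)" "v *\<^sub>R (B $ i - b)"] assms by (simp add: N_scaleR)
    then show "(u *\<^sub>R A + v *\<^sub>R B) $ i \<in> nball (u *\<^sub>R a + v *\<^sub>R b) (u * \<alpha> + v * \<beta>)" by blast
  qed
  then have "circumradius N (cfg_hull (u *\<^sub>R A + v *\<^sub>R B)) \<le> u * \<alpha> + v * \<beta>"
    using assms pos by (intro circumradius_le) auto
  also have "\<dots> = u * circumradius N (cfg_hull A) + v * circumradius N (cfg_hull B) + (u + v) * e"
    by (simp add: \<alpha>_def \<beta>_def algebra_simps)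
  finally show "circumradius N (cfg_hull (u *\<^sub>R A + v *\<^sub>R B))
    \<le> u * circumradius N (cfg_hull A) + v * circumradius N (cfg_hull B) + e"
    using assms by simp
qed

section \<open>Segments and flat configurations\<close>

lemma circumradius_pos:
  assumes "P $ i \<noteq> P $ j"
  shows "0 < circumradius N (cfg_hull P)"
proof -
  have "0 < N (P $ i - P $ j)" using assms by (simp add: less_le)
  also have "\<dots> \<le> diam N (cfg_hull P)"
    by (intro N_diff_le_diam bounded_cfg_hull cfg_hull_nth)
  also have "\<dots> \<le> 2 * circumradius N (cfg_hull P)"
    by (intro diam_le_2_circumradius bounded_cfg_hull cfg_hull_nonempty)
  finally show ?thesis by simp
qed

text \<open>The hull is a segment, and the ball about its midpoint \<open>m\<close> with half its
  length as radius contains it.\<close>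

lemma diam_two_points:
  assumes "\<And>i. P $ i \<in> {x, y}" "P $ a = x" "P $ b = y"
  shows "diam N (cfg_hull P) = 2 * circumradius N (cfg_hull P)"
proof (rule antisym)
  show "diam N (cfg_hull P) \<le> 2 * circumradius N (cfg_hull P)"
    by (intro diam_le_2_circumradius bounded_cfg_hull cfg_hull_nonempty)
  define m where "m = (1 / 2) *\<^sub>R (x + y)"
  have "x - m = (1 / 2) *\<^sub>R (x - y)" "y - m = (1 / 2) *\<^sub>R (y - x)"
    by (simp_all add: m_def algebra_simps flip: scaleR_add_left)
  then have "N (x - m) = N (x - y) / 2" "N (y - m) = N (x - y) / 2"
    using N_minus_commute[of x y] by (simp_all only: N_scaleR)
  then have "P $ i \<in> nball m (N (x - y) / 2)" for i
    using assms(1)[of i] by auto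
  then have "circumradius N (cfg_hull P) \<le> N (x - y) / 2"
    by (intro circumradius_le[of _ _ m] cfg_hull_subset convex_nball) auto
  moreover have "N (x - y) \<le> diam N (cfg_hull P)"
    using N_diff_le_diam[OF bounded_cfg_hull cfg_hull_nth cfg_hull_nth, of P a b] assms by simp
  ultimately show "2 * circumradius N (cfg_hull P) \<le> diam N (cfg_hull P)" by simp
qed

lemma inradius_cfg_flat:
  assumes "u \<noteq> 0" "\<And>i. u \<bullet> P $ i = c"
  shows "inradius N (cfg_hull P) = 0"
proof (rule inradius_flat[OF bounded_cfg_hull cfg_hull_nonempty assms(1)])
  show "cfg_hull P \<subseteq> {x. u \<bullet> x = c}"
    using assms(2) by (intro cfg_hull_subset convex_hyperplane) auto
qed

lemma flat_enlarge:
  fixes P :: "(real ^ 'n) ^ 'm"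
  assumes flat: "u \<noteq> 0" "\<And>i. u \<bullet> P $ i = c"
    and pos: "0 < circumradius N (cfg_hull P)"
    and d: "diam N (cfg_hull P) \<le> d * circumradius N (cfg_hull P)" "d \<le> 2"
  obtains Q :: "(real ^ 'n) ^ 'm" where "circumradius N (cfg_hull Q) = 1" "diam N (cfg_hull Q) = d"
    "inradius N (cfg_hull Q) = 0"
proof -
  obtain a b where ab: "P $ a \<noteq> P $ b"
  proof (rule ccontr)
    assume "\<not> thesis"
    \<comment> \<open>Here \<open>undefined\<close> is just some index: coinciding vertices would
      fit in a ball of radius 0.\<close>
    then have "P $ i = P $ undefined" for i using that by blast
    then have "cfg_hull P \<subseteq> nball (P $ undefined) 0"
      by (intro cfg_hull_subset convex_nball) (simp add: nball_zero)
    from circumradius_le[OF order_refl this] show False using pos by simp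
  qed
  \<comment> \<open>\<open>E\<close> is a segment: \<open>a\<close> keeps its vertex and all other
    indices go to \<open>P $ b\<close>. On the path from \<open>P\<close> to \<open>E\<close> the
    vertices at \<open>a\<close> and \<open>b\<close> stay fixed, so the circumradius remains
    positive and \<open>D/R\<close> moves continuously to 2.\<close>
  define E :: "(real ^ 'n) ^ 'm" where "E = (\<chi> i. if i = a then P $ a else P $ b)"
  define W where "W s = (1 - s) *\<^sub>R P + s *\<^sub>R E" for s :: real
  define \<phi> where "\<phi> s = diam N (cfg_hull (W s)) / circumradius N (cfg_hull (W s))" for s
  have "W s $ a = P $ a" "W s $ b = P $ b" for s
    using ab by (simp_all add: W_def E_def flip: scaleR_add_left)
  then have Wpos: "0 < circumradius N (cfg_hull (W s))" for s
    using ab circumradius_pos[of "W s" a b] by simp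
  have "continuous_on {0..1} W"
    unfolding W_def by (intro continuous_intros)
  then have "continuous_on {0..1} \<phi>"
    unfolding \<phi>_def using Wpos
    by (intro continuous_intros) (auto simp: less_imp_neq[THEN not_sym])
  moreover have "\<phi> 0 \<le> d"
    using d(1) pos by (simp add: \<phi>_def W_def field_simps)
  moreover have "\<phi> 1 = 2"
    using diam_two_points[of "W 1" "P $ a" "P $ b" a b] Wpos[of 1] ab
    by (simp add: \<phi>_def W_def E_def)
  ultimately obtain s where s: "0 \<le> s" "s \<le> 1" "\<phi> s = d"
    using IVT'[of \<phi> 0 d 1] d(2) by auto
  obtain Q :: "(real ^ 'n) ^ 'm" where Q: "circumradius N (cfg_hull Q) = 1"
    "diam N (cfg_hull Q) = \<phi> s"
    "inradius N (cfg_hull Q) = inradius N (cfg_hull (W s)) / circumradius N (cfg_hull (W s))"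
    using cfg_normalize[OF Wpos[of s]] unfolding \<phi>_def by metis
  \<comment> \<open>The vertices of \<open>E\<close> are vertices of \<open>P\<close>, so the whole
    path stays in the hyperplane.\<close>
  have "u \<bullet> W s $ i = (1 - s) * c + s * c" for i
    using flat(2) by (simp add: W_def E_def inner_simps)
  then have "inradius N (cfg_hull (W s)) = 0"
    using inradius_cfg_flat[OF flat(1), of "W s" c] by (simp add: algebra_simps)
  then show ?thesis using that[OF Q(1)] Q s(3) by simp
qed

subsection \<open>Moving one vertex\<close>

text \<open>Sliding along \<open>f - q1\<close> moves weight from \<open>q1\<close> to
  \<open>f\<close>. Enough weight is available: transferred to the ball about \<open>x2\<close>,
  each point still lies on or above the hyperplane of \<open>F\<close>, which bounds its original
  height from below.\<close>

lemma nball_slide: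
  assumes F: "convex F" "f \<in> F" "F \<subseteq> {x. \<eta> \<bullet> x = c}"
    and q: "c < \<eta> \<bullet> q1" "c < \<eta> \<bullet> q2"
    and sub: "nball x1 \<rho> \<subseteq> convex hull (insert q1 F)" "nball x2 \<rho> \<subseteq> convex hull (insert q2 F)"
    and le: "\<eta> \<bullet> x2 \<le> \<eta> \<bullet> x1"
  obtains z where "\<eta> \<bullet> z = \<eta> \<bullet> x2" "nball z \<rho> \<subseteq> convex hull (insert q1 F)"
proof -
  have ne: "F \<noteq> {}" using F(2) by blast
  \<comment> \<open>The weight to be moved for the centre to drop to the height of
    \<open>x2\<close>.\<close>
  define \<delta> where "\<delta> = (\<eta> \<bullet> x1 - \<eta> \<bullet> x2) / (\<eta> \<bullet> q1 - c)"
  have \<delta>: "0 \<le> \<delta>" "\<delta> * (\<eta> \<bullet> q1 - c) = \<eta> \<bullet> x1 - \<eta> \<bullet> x2"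
    using le q(1) by (auto simp: \<delta>_def)
  have \<eta>f: "\<eta> \<bullet> f = c" using F by blast
  define z where "z = x1 + \<delta> *\<^sub>R (f - q1)"
  have "\<eta> \<bullet> z = \<eta> \<bullet> x2"
    using \<delta>(2) \<eta>f by (simp add: z_def inner_simps algebra_simps)
  moreover have "nball z \<rho> \<subseteq> convex hull (insert q1 F)"
  proof
    fix y assume y: "y \<in> nball z \<rho>"
    define y1 where "y1 = y - \<delta> *\<^sub>R (f - q1)"
    have diff: "y1 - x1 = y - z" by (simp add: y1_def z_def)
    then have "y1 \<in> nball x1 \<rho>" using y by simp
    then obtain u v g where uv: "0 \<le> u" "0 \<le> v" "u + v = 1" "g \<in> F" "y1 = u *\<^sub>R q1 + v *\<^sub>R g"
      using sub(1) unfolding convex_hull_insert[OF ne] convex_hull_eq[THEN iffD2, OF F(1)] by blast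
    have "\<eta> \<bullet> g = c" using F uv by blast
    then have hy1: "\<eta> \<bullet> y1 - c = u * (\<eta> \<bullet> q1 - c)"
      using uv(3) by (simp add: uv(5) inner_simps algebra_simps flip: distrib_left)
    have "x2 + (y1 - x1) \<in> nball x2 \<rho>" using y diff by simp
    moreover have "convex hull (insert q2 F) \<subseteq> {x. c \<le> \<eta> \<bullet> x}"
      using F(3) q(2) by (intro hull_minimal convex_halfspace_ge) auto
    ultimately have "c \<le> \<eta> \<bullet> (x2 + (y1 - x1))" using sub(2) by blast
    then have "\<delta> * (\<eta> \<bullet> q1 - c) \<le> u * (\<eta> \<bullet> q1 - c)"
      using hy1 \<delta>(2) by (simp add: inner_simps)
    then have "\<delta> \<le> u" using q(1) by simp
    moreover have "y = (u - \<delta>) *\<^sub>R q1 + v *\<^sub>R g + \<delta> *\<^sub>R f"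
      using uv(5) by (simp add: y1_def algebra_simps)
    ultimately have "y \<in> convex hull {q1, g, f}"
      unfolding convex_hull_3 using uv \<delta>(1)
      by (intro CollectI exI[of _ "u - \<delta>"] exI[of _ v] exI[of _ \<delta>]) auto
    moreover have "convex hull {q1, g, f} \<subseteq> convex hull (insert q1 F)"
      using uv(4) F(2) by (intro hull_mono) auto
    ultimately show "y \<in> convex hull (insert q1 F)" by blast
  qed
  ultimately show ?thesis using that by blast
qed

text \<open>
  Both balls are first slid towards \<open>F\<close> until their centres have the same distance to the
  hyperplane of \<open>F\<close>. After that the weights \<open>\<alpha>\<close> and \<open>\<beta>\<close> below, which do not depend on the
  point of the ball, turn the two apexes into the apex \<open>\<kappa>1 q1 + \<kappa>2 q2\<close>.
\<close>

lemma nball_in_cone_quasiconcave: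
  assumes F: "convex F" "f \<in> F" "F \<subseteq> {x. \<eta> \<bullet> x = c}"
    and q: "c < \<eta> \<bullet> q1" "c < \<eta> \<bullet> q2"
    and sub: "nball x1 \<rho> \<subseteq> convex hull (insert q1 F)" "nball x2 \<rho> \<subseteq> convex hull (insert q2 F)"
    and \<kappa>: "0 \<le> \<kappa>1" "0 \<le> \<kappa>2" "\<kappa>1 + \<kappa>2 = 1"
  obtains z where "nball z \<rho> \<subseteq> convex hull (insert (\<kappa>1 *\<^sub>R q1 + \<kappa>2 *\<^sub>R q2) F)"
proof -
  have ne: "F \<noteq> {}" using F(2) by blast
  obtain z1 z2 where z: "\<eta> \<bullet> z1 = \<eta> \<bullet> z2"
    "nball z1 \<rho> \<subseteq> convex hull (insert q1 F)" "nball z2 \<rho> \<subseteq> convex hull (insert q2 F)"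
  proof (cases "\<eta> \<bullet> x2 \<le> \<eta> \<bullet> x1")
    case True
    then show ?thesis using nball_slide[OF F q sub True] that sub by metis
  next
    case False
    then have "\<eta> \<bullet> x1 \<le> \<eta> \<bullet> x2" by simp
    then show ?thesis using nball_slide[OF F q(2,1) sub(2,1)] that sub by metis
  qed
  define q where "q = \<kappa>1 *\<^sub>R q1 + \<kappa>2 *\<^sub>R q2"
  define h1 where "h1 = \<eta> \<bullet> q1 - c"
  define h2 where "h2 = \<eta> \<bullet> q2 - c"
  \<comment> \<open>The height of \<open>q\<close> over the hyperplane of \<open>F\<close>; it
    normalises the two weights below to sum 1.\<close>
  define h where "h = \<kappa>1 * h1 + \<kappa>2 * h2"
  have hpos: "0 < h1" "0 < h2" using q by (auto simp: h1_def h2_def)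
  have "0 < h"
  proof (cases "\<kappa>1 = 0")
    case True then show ?thesis using \<kappa> hpos by (simp add: h_def)
  next
    case False then show ?thesis using \<kappa> hpos by (simp add: h_def add_pos_nonneg)
  qed
  define \<alpha> where "\<alpha> = \<kappa>1 * h1 / h"
  define \<beta> where "\<beta> = \<kappa>2 * h2 / h"
  have \<alpha>\<beta>: "0 \<le> \<alpha>" "0 \<le> \<beta>" "\<alpha> + \<beta> = 1"
    using \<kappa> hpos \<open>0 < h\<close> by (auto simp: \<alpha>_def \<beta>_def h_def simp flip: add_divide_distrib)
  have "nball (\<alpha> *\<^sub>R z1 + \<beta> *\<^sub>R z2) \<rho> \<subseteq> convex hull (insert q F)"
  proof
    fix y assume y: "y \<in> nball (\<alpha> *\<^sub>R z1 + \<beta> *\<^sub>R z2) \<rho>"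
    define b where "b = y - (\<alpha> *\<^sub>R z1 + \<beta> *\<^sub>R z2)"
    have "z1 + b \<in> nball z1 \<rho>" "z2 + b \<in> nball z2 \<rho>" using y by (simp_all add: b_def)
    then have "z1 + b \<in> convex hull (insert q1 F)" "z2 + b \<in> convex hull (insert q2 F)"
      using z by blast+
    then obtain u1 v1 g1 u2 v2 g2 where
      1: "0 \<le> u1" "0 \<le> v1" "u1 + v1 = 1" "g1 \<in> F" "z1 + b = u1 *\<^sub>R q1 + v1 *\<^sub>R g1" and
      2: "0 \<le> u2" "0 \<le> v2" "u2 + v2 = 1" "g2 \<in> F" "z2 + b = u2 *\<^sub>R q2 + v2 *\<^sub>R g2"
      unfolding convex_hull_insert[OF ne] convex_hull_eq[THEN iffD2, OF F(1)] by blast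
    have "\<eta> \<bullet> g1 = c" "\<eta> \<bullet> g2 = c" using F 1 2 by blast+
    then have "\<eta> \<bullet> (z1 + b) = u1 * h1 + (u1 + v1) * c" "\<eta> \<bullet> (z2 + b) = u2 * h2 + (u2 + v2) * c"
      unfolding 1(5) 2(5) by (simp_all add: h1_def h2_def inner_simps algebra_simps)
    \<comment> \<open>The two points have equal heights. Hence the apexes enter the combination in
      the fixed ratio of \<kappa>1 to \<kappa>2, with total weight \<open>t\<close> on
      \<open>q\<close>.\<close>
    then have eq: "u2 * h2 = u1 * h1"
      using z(1) 1(3) 2(3) by (simp add: inner_simps)
    define t where "t = u1 * h1 / h"
    have t: "0 \<le> t" "\<alpha> * u1 = t * \<kappa>1" "\<beta> * u2 = t * \<kappa>2"
      using 1 hpos \<open>0 < h\<close> eq by (simp_all add: t_def \<alpha>_def \<beta>_def) (simp_all add: mult.assoc eq mult.commute)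
    have tsum: "t + \<alpha> * v1 + \<beta> * v2 = 1"
    proof -
      have "t + \<alpha> * v1 + \<beta> * v2 = t * (\<kappa>1 + \<kappa>2) + \<alpha> * v1 + \<beta> * v2" using \<kappa>(3) by simp
      also have "\<dots> = \<alpha> * (u1 + v1) + \<beta> * (u2 + v2)"
        using t(2,3) by (simp add: distrib_left)
      finally show ?thesis using 1(3) 2(3) \<alpha>\<beta>(3) by simp
    qed
    have "y = (\<alpha> *\<^sub>R z1 + \<beta> *\<^sub>R z2) + (\<alpha> + \<beta>) *\<^sub>R b" using \<alpha>\<beta>(3) by (simp add: b_def)
    also have "\<dots> = \<alpha> *\<^sub>R (z1 + b) + \<beta> *\<^sub>R (z2 + b)" by (simp add: algebra_simps)
    also have "\<dots> = (\<alpha> * u1) *\<^sub>R q1 + (\<alpha> * v1) *\<^sub>R g1 + (\<beta> * u2) *\<^sub>R q2 + (\<beta> * v2) *\<^sub>R g2"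
      unfolding 1(5) 2(5) by (simp add: algebra_simps)
    also have "\<dots> = t *\<^sub>R q + (\<alpha> * v1) *\<^sub>R g1 + (\<beta> * v2) *\<^sub>R g2"
      unfolding t(2,3) by (simp add: q_def algebra_simps)
    finally have "y \<in> convex hull {q, g1, g2}"
      unfolding convex_hull_3 using t(1) tsum \<alpha>\<beta> 1(2) 2(2)
      by (intro CollectI exI[of _ t] exI[of _ "\<alpha> * v1"] exI[of _ "\<beta> * v2"]) auto
    moreover have "convex hull {q, g1, g2} \<subseteq> convex hull (insert q F)"
      using 1(4) 2(4) by (intro hull_mono) auto
    ultimately show "y \<in> convex hull (insert q F)" by blast
  qed
  then show ?thesis unfolding q_def by (rule that)
qed

text \<open>The apexes on this side with strictly larger inradius form a set that is convex by
  quasiconcavity, open, and misses the present apex. A separating hyperplane, shifted through the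
  apex, avoids all of it.\<close>

lemma exists_nonincreasing_hyperplane:
  fixes P :: "(real ^ 'n) ^ ('m :: finite) option"
  assumes base: "cfg_base P \<subseteq> {x. \<eta> \<bullet> x = c}" and q: "c < \<eta> \<bullet> P $ None"
  obtains g where "\<And>x. c < \<eta> \<bullet> x \<Longrightarrow> g \<bullet> x = g \<bullet> P $ None \<Longrightarrow>
    inradius N (cfg_hull (set_apex P x)) \<le> inradius N (cfg_hull P)"
proof -
  let ?r = "\<lambda>x. inradius N (cfg_hull (set_apex P x))"
  let ?q = "P $ None"
  define C where "C = {x. c < \<eta> \<bullet> x \<and> inradius N (cfg_hull P) < ?r x}"
  have "open C"
    unfolding C_def
    by (intro open_Collect_conj open_Collect_less continuous_intros continuous_on_set_apex) auto
  have "convex C"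
  proof (rule convexI)
    fix x y and u v :: real
    assume xy: "x \<in> C" "y \<in> C" and uv: "0 \<le> u" "0 \<le> v" "u + v = 1"
    have less: "inradius N (cfg_hull P) < ?r x" "inradius N (cfg_hull P) < ?r y"
      using xy by (simp_all add: C_def)
    obtain \<rho>1 x1 where 1: "inradius N (cfg_hull P) < \<rho>1" "0 \<le> \<rho>1" "nball x1 \<rho>1 \<subseteq> cfg_hull (set_apex P x)"
      using less_inradius[OF cfg_hull_nonempty less(1)] by metis
    obtain \<rho>2 x2 where 2: "inradius N (cfg_hull P) < \<rho>2" "0 \<le> \<rho>2" "nball x2 \<rho>2 \<subseteq> cfg_hull (set_apex P y)"
      using less_inradius[OF cfg_hull_nonempty less(2)] by metis
    \<comment> \<open>The smaller radius serves both balls and is still above the old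
      inradius.\<close>
    define \<rho> where "\<rho> = min \<rho>1 \<rho>2"
    have \<rho>: "inradius N (cfg_hull P) < \<rho>" using 1 2 by (simp add: \<rho>_def)
    have sub: "nball x1 \<rho> \<subseteq> convex hull (insert x (cfg_base P))"
      "nball x2 \<rho> \<subseteq> convex hull (insert y (cfg_base P))"
      using 1(3) 2(3) by (auto simp: \<rho>_def cfg_hull_set_apex)
    have "convex (cfg_base P)" "P $ Some undefined \<in> cfg_base P"
      by (auto simp: cfg_base_def intro: hull_inc)
    then obtain z where z: "nball z \<rho> \<subseteq> convex hull (insert (u *\<^sub>R x + v *\<^sub>R y) (cfg_base P))"
      using nball_in_cone_quasiconcave[OF _ _ base _ _ sub uv] xy unfolding C_def by blast
    have "\<rho> \<le> ?r (u *\<^sub>R x + v *\<^sub>R y)"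
    proof (rule inradius_ge[OF bounded_cfg_hull])
      show "0 \<le> \<rho>" using \<rho> inradius_nonneg[OF bounded_cfg_hull cfg_hull_nonempty, of P] by simp
      show "nball z \<rho> \<subseteq> cfg_hull (set_apex P (u *\<^sub>R x + v *\<^sub>R y))"
        using z by (simp add: cfg_hull_set_apex)
    qed
    moreover have "c < \<eta> \<bullet> (u *\<^sub>R x + v *\<^sub>R y)"
      using convexD[OF convex_halfspace_gt[of c \<eta>], of x y u v] xy uv by (simp add: C_def)
    ultimately show "u *\<^sub>R x + v *\<^sub>R y \<in> C" using \<rho> by (simp add: C_def)
  qed
  show ?thesis
  proof (cases "C = {}")
    case True
    \<comment> \<open>With \<open>C\<close> empty, every \<open>g\<close> serves.\<close>
    show ?thesis
    proof (rule that)
      fix x assume "c < \<eta> \<bullet> x"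
      moreover have "x \<notin> C" using True by simp
      ultimately show "?r x \<le> inradius N (cfg_hull P)" by (simp add: C_def not_less)
    qed
  next
    case False
    have "?q \<notin> C" by (simp add: C_def set_apex_same)
    then have "{?q} \<inter> C = {}" by simp
    from separating_hyperplane_sets[OF convex_singleton \<open>convex C\<close> insert_not_empty False this]
    obtain g b where g: "g \<noteq> 0" "\<And>x. x \<in> C \<Longrightarrow> b \<le> g \<bullet> x" "g \<bullet> ?q \<le> b"
      by blast
    show ?thesis
    proof (rule that[of g])
      fix x assume x: "c < \<eta> \<bullet> x" "g \<bullet> x = g \<bullet> ?q"
      show "?r x \<le> inradius N (cfg_hull P)"
      proof (rule ccontr)
        assume "\<not> ?thesis"
        then have "x \<in> C" using x by (simp add: C_def)
        then obtain e where e: "0 < e" "ball x e \<subseteq> C"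
          using \<open>open C\<close> open_contains_ball by blast
        \<comment> \<open>A small step against \<open>g\<close> stays in the open set
          \<open>C\<close> but drops strictly below \<open>b\<close>.\<close>
        define y where "y = x - (e / (2 * norm g)) *\<^sub>R g"
        have "y \<in> ball x e" using e(1) g(1) by (simp add: y_def dist_norm)
        then have "b \<le> g \<bullet> y" using e g by blast
        moreover have "0 < e / (2 * norm g) * (g \<bullet> g)" using e(1) g(1) by simp
        ultimately show False using x(2) g(3) by (simp add: y_def inner_simps)
      qed
    qed
  qed
qed

text \<open>Dimension at least 2 supplies \<open>w\<close> orthogonal to \<open>g\<close>. If
  \<open>R\<close> fell below its value at the apex in both directions along \<open>w\<close>,
  convexity would fail at the apex between the two points.\<close>

lemma exists_nondecreasing_direction:
  fixes P :: "(real ^ 'n) ^ ('m :: finite) option"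
  assumes "CARD('n) \<ge> 2"
  obtains v where "v \<noteq> 0" "g \<bullet> v = 0"
    "\<And>t. 0 \<le> t \<Longrightarrow>
      circumradius N (cfg_hull P) \<le> circumradius N (cfg_hull (set_apex P (P $ None + t *\<^sub>R v)))"
proof -
  let ?q = "P $ None"
  let ?R = "\<lambda>x. circumradius N (cfg_hull (set_apex P x))"
  obtain w where w: "w \<noteq> 0" "g \<bullet> w = 0"
    using orthogonal_to_vector_exists[of g] assms by (auto simp: orthogonal_def)
  have "(\<forall>t\<ge>0. ?R ?q \<le> ?R (?q + t *\<^sub>R w)) \<or> (\<forall>t\<ge>0. ?R ?q \<le> ?R (?q + t *\<^sub>R (- w)))"
  proof (rule ccontr)
    assume "\<not> ?thesis"
    then obtain s t where st: "0 \<le> s" "0 \<le> t" "?R (?q + s *\<^sub>R w) < ?R ?q" "?R (?q + t *\<^sub>R (- w)) < ?R ?q"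
      by (auto simp: not_le)
    have "s \<noteq> 0" "t \<noteq> 0" using st(3,4) by (metis add.right_neutral less_irrefl scaleR_zero_left)+
    then have st0: "0 < s" "0 < t" using st by auto
    \<comment> \<open>These weights make the apex a convex combination of the two points, as
      \<open>u * s = v * t\<close> cancels \<open>w\<close>.\<close>
    define u where "u = t / (s + t)"
    define v where "v = s / (s + t)"
    have uv: "0 < u" "0 < v" "u + v = 1" "u * s = v * t"
      using st0 by (auto simp: u_def v_def simp flip: add_divide_distrib)
    have "u *\<^sub>R (?q + s *\<^sub>R w) + v *\<^sub>R (?q + t *\<^sub>R (- w)) = (u + v) *\<^sub>R ?q + (u * s - v * t) *\<^sub>R w"
      by (simp add: algebra_simps)
    then have "?R ?q = ?R (u *\<^sub>R (?q + s *\<^sub>R w) + v *\<^sub>R (?q + t *\<^sub>R (- w)))"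
      using uv by simp
    also have "\<dots> \<le> u * ?R (?q + s *\<^sub>R w) + v * ?R (?q + t *\<^sub>R (- w))"
      unfolding set_apex_combine[OF uv(3)] using uv by (intro circumradius_convex) auto
    also have "\<dots> < u * ?R ?q + v * ?R ?q"
      using uv st by (intro add_strict_mono mult_strict_left_mono) auto
    also have "\<dots> = ?R ?q" using uv(3) by (simp flip: distrib_right)
    finally show False by simp
  qed
  then show ?thesis
  proof
    assume "\<forall>t\<ge>0. ?R ?q \<le> ?R (?q + t *\<^sub>R w)"
    then show ?thesis using w by (intro that[of w]) (auto simp: set_apex_same)
  next
    assume "\<forall>t\<ge>0. ?R ?q \<le> ?R (?q + t *\<^sub>R (- w))"
    then show ?thesis using w by (intro that[of "- w"]) (auto simp: set_apex_same)
  qed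
qed

text \<open>
  The quotients \<open>r/R\<close> and \<open>D/R\<close> are scale invariant. Moving the apex \<open>q\<close> to \<open>q + t v\<close> with
  \<open>t \<rightarrow> \<infinity>\<close> makes the shape converge to a segment, for which \<open>D/R = 2\<close>; the path \<open>W\<close> is
  this motion, rescaled by \<open>s = 1 / (1 + t)\<close> so that the limit is reached at \<open>s = 0\<close>.
\<close>

lemma cfg_enlarge_diam:
  fixes P :: "(real ^ 'n) ^ 'n option"
  assumes n: "CARD('n) \<ge> 2"
    and R: "circumradius N (cfg_hull P) = 1"
    and d: "diam N (cfg_hull P) \<le> d" "d \<le> 2"
  obtains Q :: "(real ^ 'n) ^ 'n option" where "circumradius N (cfg_hull Q) = 1"
    "diam N (cfg_hull Q) = d" "inradius N (cfg_hull Q) \<le> inradius N (cfg_hull P)"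
proof (cases "\<exists>u c. u \<noteq> 0 \<and> (\<forall>i. u \<bullet> P $ i = c)")
  case True
  then obtain u c where "u \<noteq> 0" "\<And>i. u \<bullet> P $ i = c" by blast
  then obtain Q :: "(real ^ 'n) ^ 'n option" where "circumradius N (cfg_hull Q) = 1"
    "diam N (cfg_hull Q) = d" "inradius N (cfg_hull Q) = 0"
    using flat_enlarge[of u P c d] R d by auto
  then show ?thesis
    using that inradius_nonneg[OF bounded_cfg_hull cfg_hull_nonempty, of P] by auto
next
  case False
  let ?q = "P $ None"
  obtain \<eta> c where \<eta>: "\<eta> \<noteq> 0" "cfg_base P \<subseteq> {x. \<eta> \<bullet> x = c}" "c < \<eta> \<bullet> ?q"
    using full_cfg_apex[OF False] .
  have basepoint: "\<eta> \<bullet> P $ Some i = c" for i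
    using \<eta>(2) hull_inc[of "P $ Some i" "range (\<lambda>i. P $ Some i)" convex]
    unfolding cfg_base_def by auto
  obtain g where g: "\<And>x. c < \<eta> \<bullet> x \<Longrightarrow> g \<bullet> x = g \<bullet> ?q \<Longrightarrow>
      inradius N (cfg_hull (set_apex P x)) \<le> inradius N (cfg_hull P)"
    using exists_nonincreasing_hyperplane[OF \<eta>(2,3)] by blast
  obtain v where v: "v \<noteq> 0" "g \<bullet> v = 0"
    "\<And>t. 0 \<le> t \<Longrightarrow> 1 \<le> circumradius N (cfg_hull (set_apex P (?q + t *\<^sub>R v)))"
    using exists_nondecreasing_direction[OF n, of g P] R by metis
  define W :: "real \<Rightarrow> (real ^ 'n) ^ 'n option" where
    "W s = s *\<^sub>R P + (1 - s) *\<^sub>R set_apex 0 v" for s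
  \<comment> \<open>The apex before rescaling: \<open>W s\<close> is \<open>s\<close> times
    \<open>P\<close> with its apex moved to \<open>x s\<close>, that is,
    \<open>t = (1 - s) / s\<close>.\<close>
  define x where "x s = ?q + ((1 - s) / s) *\<^sub>R v" for s
  have W_nth: "W s $ None = s *\<^sub>R ?q + (1 - s) *\<^sub>R v" "W s $ Some i = s *\<^sub>R P $ Some i" for s i
    by (simp_all add: W_def)
  have W_eq: "W s = (\<chi> i. 0 + s *\<^sub>R set_apex P (x s) $ i)" if "0 < s" for s
  proof -
    have "W s $ i = s *\<^sub>R set_apex P (x s) $ i" for i
      using that by (cases i) (auto simp: W_nth x_def scaleR_add_right)
    then show ?thesis by (simp add: vec_eq_iff)
  qed
  have W_pos: "s \<le> circumradius N (cfg_hull (W s))" if "0 < s" "s \<le> 1" for s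
  proof -
    have "1 \<le> circumradius N (cfg_hull (set_apex P (x s)))"
      unfolding x_def using that by (intro v(3)) simp
    then have "s * 1 \<le> s * circumradius N (cfg_hull (set_apex P (x s)))"
      using that by (intro mult_left_mono) auto
    then show ?thesis unfolding W_eq[OF that(1)] functionals_scale[OF that(1)] by simp
  qed
  have W0: "0 < circumradius N (cfg_hull (W 0))"
    using circumradius_pos[of "W 0" None "Some undefined"] v(1) by (simp add: W_nth)
  have Wpos: "0 < circumradius N (cfg_hull (W s))" if "0 \<le> s" "s \<le> 1" for s
    using W0 W_pos[of s] that by (cases "s = 0") auto
  \<comment> \<open>The height of the apex of \<open>W s\<close> over the hyperplane at level
    \<open>s * c\<close> that contains its base. Positivity keeps \<open>x s\<close> on the side
    where the choice of \<open>g\<close> controls the inradius.\<close>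
  define \<psi> where "\<psi> s = s * (\<eta> \<bullet> ?q - c) + (1 - s) * (\<eta> \<bullet> v)" for s
  have W_inradius: "inradius N (cfg_hull (W s)) \<le> s * inradius N (cfg_hull P)"
    if s: "0 < s" "s \<le> 1" "0 < \<psi> s" for s
  proof -
    have "s * (\<eta> \<bullet> x s - c) = \<psi> s"
      using s(1) by (simp add: x_def \<psi>_def inner_simps field_simps)
    then have "0 < s * (\<eta> \<bullet> x s - c)" using s(3) by simp
    then have "c < \<eta> \<bullet> x s" using s(1) by (simp add: zero_less_mult_iff)
    moreover have "g \<bullet> x s = g \<bullet> ?q" using v(2) by (simp add: x_def inner_simps)
    ultimately have "inradius N (cfg_hull (set_apex P (x s))) \<le> inradius N (cfg_hull P)"
      by (rule g)
    then show ?thesis unfolding W_eq[OF s(1)] functionals_scale[OF s(1)] using s by simp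
  qed
  \<comment> \<open>Coming down from \<open>s = 1\<close>, \<open>s0\<close> is the first parameter
    at which \<open>W\<close> is flat: either the limiting segment or the moment when the apex
    reaches the base hyperplane.\<close>
  obtain s0 u e where s0: "0 \<le> s0" "s0 < 1" "u \<noteq> 0" "\<And>i. u \<bullet> W s0 $ i = e"
    "\<And>s. s0 < s \<Longrightarrow> s \<le> 1 \<Longrightarrow> 0 < \<psi> s"
  proof (cases "0 \<le> \<eta> \<bullet> v")
    case True
    \<comment> \<open>The apex never comes down here; \<open>W 0\<close> has only the vertices 0 and
      \<open>v\<close>, so any hyperplane through both will do.\<close>
    obtain u where u: "u \<noteq> 0" "v \<bullet> u = 0"
      using orthogonal_to_vector_exists[of v] n by (auto simp: orthogonal_def)
    have "u \<bullet> W 0 $ i = 0" for i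
      using u(2) by (cases i) (auto simp: W_nth inner_commute)
    moreover have "0 < \<psi> s" if "0 < s" "s \<le> 1" for s
      unfolding \<psi>_def using that True \<eta>(3) by (intro add_pos_nonneg) auto
    ultimately show ?thesis using that[of 0 u 0] u(1) by auto
  next
    case False
    \<comment> \<open>\<psi> is affine with slope \<open>k\<close>, and \<open>s0\<close> is its
      zero.\<close>
    define k where "k = \<eta> \<bullet> ?q - c - \<eta> \<bullet> v"
    define s0 where "s0 = - (\<eta> \<bullet> v) / k"
    have k: "0 < k" using False \<eta>(3) by (simp add: k_def)
    have \<psi>_eq: "\<psi> s = k * (s - s0)" for s
    proof -
      have "k * (s - s0) = k * s + \<eta> \<bullet> v" using k by (simp add: s0_def field_simps)
      then show ?thesis by (simp add: \<psi>_def k_def algebra_simps)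
    qed
    have "0 \<le> s0"
      unfolding s0_def using k False by (intro divide_nonneg_pos) auto
    moreover have "s0 < 1"
      unfolding s0_def pos_divide_less_eq[OF k] using \<eta>(3) by (simp add: k_def)
    moreover have "\<eta> \<bullet> W s0 $ i = s0 * c" for i
    proof (cases i)
      case None
      then show ?thesis
        using \<psi>_eq[of s0] by (simp add: W_nth \<psi>_def inner_simps algebra_simps)
    next
      case (Some j)
      then show ?thesis by (simp add: W_nth basepoint)
    qed
    ultimately show ?thesis
      using that[of s0 \<eta> "s0 * c"] \<eta>(1) k by (auto simp: \<psi>_eq)
  qed
  show ?thesis
  proof (cases "diam N (cfg_hull (W s0)) \<le> d * circumradius N (cfg_hull (W s0))")
    case True
    \<comment> \<open>At \<open>s0\<close> the quotient \<open>D/R\<close> is at most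
      \<open>d\<close>, so the flat case finishes with inradius 0.\<close>
    obtain Q :: "(real ^ 'n) ^ 'n option" where "circumradius N (cfg_hull Q) = 1"
      "diam N (cfg_hull Q) = d" "inradius N (cfg_hull Q) = 0"
      using flat_enlarge[OF s0(3,4) Wpos True d(2)] s0 by auto
    then show ?thesis
      using that inradius_nonneg[OF bounded_cfg_hull cfg_hull_nonempty, of P] by auto
  next
    case False
    define \<phi> where "\<phi> s = diam N (cfg_hull (W s)) / circumradius N (cfg_hull (W s))" for s
    have "continuous_on {s0..1} W"
      unfolding W_def by (intro continuous_intros)
    then have "continuous_on {s0..1} \<phi>"
      unfolding \<phi>_def using Wpos s0(1)
      by (intro continuous_intros) (auto simp: less_imp_neq[THEN not_sym])
    moreover have "d < \<phi> s0"
      using False Wpos[of s0] s0 by (simp add: \<phi>_def field_simps)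
    moreover have "W 1 = P" by (simp add: W_def)
    then have "\<phi> 1 \<le> d" using d(1) R by (simp add: \<phi>_def)
    ultimately obtain s where s: "s0 \<le> s" "s \<le> 1" "\<phi> s = d"
      using IVT2'[of \<phi> 1 d s0] s0(2) by auto
    \<comment> \<open>Strictness matters: it makes \<open>s\<close> positive, so that rescaling is
      possible, and keeps the apex off the base hyperplane.\<close>
    then have "s0 < s" using \<open>d < \<phi> s0\<close> by (cases "s = s0") auto
    then have s': "0 < s" "0 < \<psi> s" using s0 s(2) by auto
    note pos = Wpos[OF less_imp_le[OF s'(1)] s(2)]
    obtain Q :: "(real ^ 'n) ^ 'n option" where Q: "circumradius N (cfg_hull Q) = 1"
      "diam N (cfg_hull Q) = \<phi> s"
      "inradius N (cfg_hull Q) = inradius N (cfg_hull (W s)) / circumradius N (cfg_hull (W s))"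
      using cfg_normalize[OF pos] unfolding \<phi>_def by metis
    have "inradius N (cfg_hull (W s)) \<le> s * inradius N (cfg_hull P)"
      using W_inradius s'(1) s(2) s'(2) .
    \<comment> \<open>The circumradius of \<open>W s\<close> is at least \<open>s\<close>, so
      normalising to \<open>R = 1\<close> absorbs the factor \<open>s\<close>.\<close>
    also have "\<dots> \<le> circumradius N (cfg_hull (W s)) * inradius N (cfg_hull P)"
      using W_pos[OF s'(1) s(2)] inradius_nonneg[OF bounded_cfg_hull cfg_hull_nonempty, of P]
      by (rule mult_right_mono)
    finally have "inradius N (cfg_hull Q) \<le> inradius N (cfg_hull P)"
      unfolding Q(3) using pos by (simp add: field_simps)
    then show ?thesis using that Q s(3) by blast
  qed
qed

subsection \<open>Reduction of convex bodies to configurations\<close>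

lemma nball_family_inter:
  fixes X :: "(real ^ 'n) set"
  assumes "finite X"
    and small: "\<And>Y. Y \<subseteq> X \<Longrightarrow> Y \<noteq> {} \<Longrightarrow> card Y \<le> CARD('n) + 1 \<Longrightarrow> \<Inter> ((\<lambda>x. nball x \<rho>) ` Y) \<noteq> {}"
  shows "\<Inter> ((\<lambda>x. nball x \<rho>) ` X) \<noteq> {}"
proof -
  let ?S = "\<lambda>x. nball x \<rho>"
  have small': "\<Inter> T \<noteq> {}" if T: "T \<subseteq> ?S ` X" "card T \<le> CARD('n) + 1" for T
  proof (cases "T = {}")
    case False
    \<comment> \<open>One centre is chosen per ball, so that the cardinality bound passes from balls
      to centres.\<close>
    obtain Y where Y: "Y \<subseteq> X" "T = ?S ` Y" "inj_on ?S Y"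
      using T(1) unfolding subset_image_inj by blast
    then have "card Y \<le> CARD('n) + 1" using T(2) by (simp add: card_image)
    then show ?thesis using small[OF Y(1)] Y(2) False by blast
  qed simp
  show ?thesis
  proof (cases "card (?S ` X) \<le> CARD('n) + 1")
    \<comment> \<open>Helly's theorem below asks for at least \<open>n + 1\<close> sets; small
      families are settled directly.\<close>
    case True
    then show ?thesis using small'[of "?S ` X"] by simp
  next
    case False
    show ?thesis
    proof (rule Helly)
      show "DIM(real ^ 'n) + 1 \<le> card (?S ` X)" using False by simp
      show "\<forall>s\<in>?S ` X. convex s" using convex_nball by blast
    qed (use small' in auto)
  qed
qed

text \<open>\<open>P\<close> maximises the circumradius over \<open>n + 1\<close> points of
  \<open>K\<close>. For \<rho> above this maximum, any \<open>n + 1\<close> balls of radius \<rho>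
  about points of \<open>K\<close> meet; Helly's theorem and compactness give a point common to all
  such balls, and it is a centre for \<open>K\<close>.\<close>

lemma circumradius_attained_by_cfg:
  assumes "convex_body K"
  obtains P :: "(real ^ 'n) ^ 'n option"
  where "cfg_hull P \<subseteq> K" "circumradius N (cfg_hull P) = circumradius N K"
proof -
  have K: "K \<noteq> {}" "convex K" "compact K" using assms by (auto simp: convex_body_def)
  let ?X = "{P :: (real ^ 'n) ^ 'n option. \<forall>i. P $ i \<in> K}"
  obtain y where "y \<in> K" using K by blast
  then have "(\<chi> i. y) \<in> ?X" by simp
  then have "?X \<noteq> {}" by blast
  then obtain P where P: "P \<in> ?X"
    "\<And>Q. Q \<in> ?X \<Longrightarrow> circumradius N (cfg_hull Q) \<le> circumradius N (cfg_hull P)"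
    using continuous_attains_sup[OF compact_cfgs[OF K(3)] _ continuous_on_circumradius] by blast
  have sub: "cfg_hull P \<subseteq> K" using P(1) K(2) by (intro cfg_hull_subset) auto
  have "circumradius N K \<le> circumradius N (cfg_hull P)"
  proof (rule field_le_epsilon)
    fix e :: real assume e: "0 < e"
    define \<rho> where "\<rho> = circumradius N (cfg_hull P) + e"
    have "\<Inter> ((\<lambda>x. nball x \<rho>) ` K) \<noteq> {}"
    proof (rule compact_fip_Heine_Borel)
      show "compact T" if "T \<in> (\<lambda>x. nball x \<rho>) ` K" for T
        using that compact_nball by blast
      fix \<F> assume "finite \<F>" "\<F> \<subseteq> (\<lambda>x. nball x \<rho>) ` K"
      then obtain X where X: "finite X" "X \<subseteq> K" "\<F> = (\<lambda>x. nball x \<rho>) ` X"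
        by (meson finite_subset_image)
      show "\<Inter> \<F> \<noteq> {}"
        unfolding X(3)
      proof (rule nball_family_inter[OF X(1)])
        fix Y assume Y: "Y \<subseteq> X" "Y \<noteq> {}" "card Y \<le> CARD('n) + 1"
        then obtain Q :: "(real ^ 'n) ^ 'n option" where Q: "range (($) Q) = Y"
          using exists_cfg_range[of Y, where 'm = "'n option"] finite_subset[OF _ X(1)] by auto
        then have "Q \<in> ?X" using Y(1) X(2) by auto
        then have "circumradius N (cfg_hull Q) < \<rho>" using P(2) e by (force simp: \<rho>_def)
        then obtain c where c: "cfg_hull Q \<subseteq> nball c \<rho>"
          using circumradius_less[OF bounded_cfg_hull] by blast
        have "Y \<subseteq> cfg_hull Q" unfolding cfg_hull_def Q by (rule hull_subset)
        then have "c \<in> nball y \<rho>" if "y \<in> Y" for y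
          using c that N_minus_commute[of y c] by auto
        then show "\<Inter> ((\<lambda>x. nball x \<rho>) ` Y) \<noteq> {}" by blast
      qed
    qed
    then obtain c where "\<And>x. x \<in> K \<Longrightarrow> N (c - x) \<le> \<rho>" by auto
    then have "K \<subseteq> nball c \<rho>" by (auto simp: N_minus_commute)
    moreover have "0 \<le> \<rho>"
      using e circumradius_nonneg[OF bounded_cfg_hull, of P] by (simp add: \<rho>_def)
    ultimately show "circumradius N K \<le> circumradius N (cfg_hull P) + e"
      unfolding \<rho>_def[symmetric] by (intro circumradius_le)
  qed
  moreover have "circumradius N (cfg_hull P) \<le> circumradius N K"
    using compact_imp_bounded[OF K(3)] sub by (rule circumradius_mono)
  ultimately show ?thesis using that sub by force
qed

text \<open>Scaling gives \<open>R = 1\<close>; the translation puts all vertices in one fixed ball,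
  so that later minimisations run over a compact set of configurations.\<close>

lemma body_to_cfg:
  assumes K: "convex_body K" and pos: "0 < circumradius N K"
  obtains P :: "(real ^ 'n) ^ 'n option"
  where "\<forall>i. P $ i \<in> nball 0 2" "circumradius N (cfg_hull P) = 1"
    "diam N (cfg_hull P) \<le> diam N K / circumradius N K"
    "inradius N (cfg_hull P) \<le> inradius N K / circumradius N K"
proof -
  have bK: "bounded K" using K by (simp add: convex_body_def compact_imp_bounded)
  obtain P :: "(real ^ 'n) ^ 'n option"
    where P: "cfg_hull P \<subseteq> K" "circumradius N (cfg_hull P) = circumradius N K"
    using circumradius_attained_by_cfg[OF K] .
  have le: "diam N (cfg_hull P) \<le> diam N K" "inradius N (cfg_hull P) \<le> inradius N K"
    using diam_mono[OF bK cfg_hull_nonempty P(1)] inradius_mono[OF bK cfg_hull_nonempty P(1)] .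
  let ?s = "inverse (circumradius N K)"
  have s: "0 < ?s" using pos by simp
  \<comment> \<open>A centre exists for any radius above the circumradius; doubling it leaves the
    bound 2 after scaling.\<close>
  obtain c where c: "cfg_hull P \<subseteq> nball c (2 * circumradius N K)"
    using circumradius_less[OF bounded_cfg_hull, of P "2 * circumradius N K"] P(2) pos by auto
  note * = functionals_scale[OF s, of "- (?s *\<^sub>R c)" P]
  show ?thesis
  proof (rule that[of "\<chi> i. - (?s *\<^sub>R c) + ?s *\<^sub>R P $ i"])
    have "N (- (?s *\<^sub>R c) + ?s *\<^sub>R P $ i) \<le> 2" for i
    proof -
      have "- (?s *\<^sub>R c) + ?s *\<^sub>R P $ i = ?s *\<^sub>R (P $ i - c)" by (simp add: scaleR_diff_right)
      then have "N (- (?s *\<^sub>R c) + ?s *\<^sub>R P $ i) = ?s * N (P $ i - c)"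
        using s by (simp only: N_scaleR abs_of_pos)
      also have "\<dots> \<le> ?s * (2 * circumradius N K)"
        using c cfg_hull_nth[of P i] s by (intro mult_left_mono) auto
      also have "\<dots> = 2" using pos by simp
      finally show ?thesis .
    qed
    then show "\<forall>i. (\<chi> i. - (?s *\<^sub>R c) + ?s *\<^sub>R P $ i) $ i \<in> nball 0 2" by simp
    show "circumradius N (cfg_hull (\<chi> i. - (?s *\<^sub>R c) + ?s *\<^sub>R P $ i)) = 1"
      unfolding * P(2) using pos by simp
    show "diam N (cfg_hull (\<chi> i. - (?s *\<^sub>R c) + ?s *\<^sub>R P $ i)) \<le> diam N K / circumradius N K"
      unfolding * using le(1) pos by (simp add: field_simps)
    show "inradius N (cfg_hull (\<chi> i. - (?s *\<^sub>R c) + ?s *\<^sub>R P $ i))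
        \<le> inradius N K / circumradius N K"
      unfolding * using le(2) pos by (simp add: field_simps)
  qed
qed

section \<open>Extremal configurations\<close>

lemma circumradius_le_diam:
  assumes "bounded K" "K \<noteq> {}"
  shows "circumradius N K \<le> diam N K"
proof -
  obtain x where x: "x \<in> K" using assms(2) by blast
  then have "0 \<le> diam N K" using N_diff_le_diam[OF assms(1) x x] by simp
  moreover have "K \<subseteq> nball x (diam N K)"
    using N_diff_le_diam[OF assms(1) _ x] by blast
  ultimately show ?thesis by (rule circumradius_le)
qed

text \<open>Makes the feasible set nonempty for every \<open>D\<close> from
  \<open>1 / jung_constant N\<close> on. The configuration minimises the diameter at
  \<open>R = 1\<close>, and the reciprocal of the minimum bounds all quotients
  \<open>R/D\<close>.\<close>

lemma exists_cfg_jung: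
  obtains P :: "(real ^ 'n) ^ 'n option"
  where "\<forall>i. P $ i \<in> nball 0 2" "circumradius N (cfg_hull P) = 1"
    "diam N (cfg_hull P) \<le> 1 / jung_constant N"
proof -
  let ?J = "{circumradius N K / diam N K | K. convex_body K \<and> \<not> is_singleton K}"
  define X where "X = {P :: (real ^ 'n) ^ 'n option. \<forall>i. P $ i \<in> nball 0 2} \<inter>
    {P. circumradius N (cfg_hull P) = 1}"
  obtain u where u: "N u = 1" by (rule exists_unit)
  define S :: "(real ^ 'n) ^ 'n option" where "S = set_apex 0 u"
  have "u \<noteq> 0" using u by auto
  then have S: "0 < circumradius N (cfg_hull S)"
    using circumradius_pos[of S None "Some undefined"] by (simp add: S_def)
  have "S $ i \<in> {u, 0}" for i by (cases i) (auto simp: S_def)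
  then have DS: "diam N (cfg_hull S) = 2 * circumradius N (cfg_hull S)"
    using diam_two_points[of S u 0 None "Some undefined"] by (simp add: S_def)
  have "\<not> is_singleton (cfg_hull S)"
    using cfg_hull_nth[of S None] cfg_hull_nth[of S "Some undefined"] \<open>u \<noteq> 0\<close>
    by (auto simp: is_singleton_def S_def)
  \<comment> \<open>A segment has \<open>R/D = 1/2\<close>, which makes the supremum positive, so
    that it can be inverted.\<close>
  then have half: "1 / 2 \<in> ?J"
    using convex_body_cfg_hull[of S] S DS by (force intro!: exI[of _ "cfg_hull S"])
  have "closed {P :: (real ^ 'n) ^ 'n option. circumradius N (cfg_hull P) = 1}"
    by (intro closed_Collect_eq continuous_intros) auto
  then have co: "compact X"
    unfolding X_def by (rule compact_Int_closed[OF compact_cfgs[OF compact_nball]])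
  have ne: "X \<noteq> {}"
  proof -
    obtain P :: "(real ^ 'n) ^ 'n option"
      where "\<forall>i. P $ i \<in> nball 0 2" "circumradius N (cfg_hull P) = 1"
      by (rule body_to_cfg[OF convex_body_cfg_hull S]) blast
    then have "P \<in> X" by (simp add: X_def)
    then show ?thesis by blast
  qed
  obtain P where P: "P \<in> X"
    "\<And>Q. Q \<in> X \<Longrightarrow> diam N (cfg_hull P) \<le> diam N (cfg_hull Q)"
    using continuous_attains_inf[OF co ne continuous_on_diam] by blast
  let ?\<delta> = "diam N (cfg_hull P)"
  have \<delta>: "1 \<le> ?\<delta>"
    using circumradius_le_diam[OF bounded_cfg_hull cfg_hull_nonempty, of P] P(1)
    by (simp add: X_def)
  have le: "j \<le> 1 / ?\<delta>" if j: "j \<in> ?J" for j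
  proof -
    obtain K where K: "j = circumradius N K / diam N K" "convex_body K" "\<not> is_singleton K"
      using j by blast
    then have bK: "bounded K" "K \<noteq> {}" by (auto simp: convex_body_def compact_imp_bounded)
    obtain x y where xy: "x \<in> K" "y \<in> K" "x \<noteq> y"
      using K(3) bK(2) by (metis is_singletonI')
    then have "0 < N (x - y)" by (simp add: less_le)
    then have D: "0 < diam N K" using N_diff_le_diam[OF bK(1) xy(1,2)] by simp
    then have R: "0 < circumradius N K" using diam_le_2_circumradius[OF bK] by simp
    obtain Q :: "(real ^ 'n) ^ 'n option" where Q: "\<forall>i. Q $ i \<in> nball 0 2"
      "circumradius N (cfg_hull Q) = 1" "diam N (cfg_hull Q) \<le> diam N K / circumradius N K"
      using body_to_cfg[OF K(2) R] by blast
    then have "?\<delta> \<le> diam N K / circumradius N K" using P(2)[of Q] by (simp add: X_def)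
    then show ?thesis using D R \<delta> by (simp add: K(1) field_simps)
  qed
  have "jung_constant N \<le> 1 / ?\<delta>"
    unfolding jung_constant_def using half le by (intro cSup_least) auto
  moreover have "1 / 2 \<le> jung_constant N"
    unfolding jung_constant_def using half le by (intro cSup_upper bdd_aboveI[of _ "1 / ?\<delta>"]) auto
  ultimately have "?\<delta> \<le> 1 / jung_constant N" using \<delta> by (simp add: field_simps)
  then show ?thesis using that[of P] P(1) by (simp add: X_def)
qed

text \<open>Passing to \<open>n + 1\<close> points may shrink the diameter, so the minimum is first
  taken over diameters at most \<open>d\<close>; enlarging the diameter then restores
  equality.\<close>

lemma exists_optimal_cfg:
  assumes n: "CARD('n) \<ge> 2" and d: "1 / jung_constant N \<le> d" "d \<le> 2"
  obtains Q :: "(real ^ 'n) ^ 'n option"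
  where "circumradius N (cfg_hull Q) = 1" "diam N (cfg_hull Q) = d"
    "\<And>K. convex_body K \<Longrightarrow> circumradius N K = 1 \<Longrightarrow> diam N K \<le> d \<Longrightarrow>
      inradius N (cfg_hull Q) \<le> inradius N K"
proof -
  define X where "X = {P :: (real ^ 'n) ^ 'n option. \<forall>i. P $ i \<in> nball 0 2} \<inter>
    {P. circumradius N (cfg_hull P) = 1 \<and> diam N (cfg_hull P) \<le> d}"
  have "closed {P :: (real ^ 'n) ^ 'n option. circumradius N (cfg_hull P) = 1 \<and>
      diam N (cfg_hull P) \<le> d}"
    by (intro closed_Collect_conj closed_Collect_eq closed_Collect_le continuous_intros) auto
  then have co: "compact X"
    unfolding X_def by (rule compact_Int_closed[OF compact_cfgs[OF compact_nball]])
  have ne: "X \<noteq> {}"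
  proof -
    obtain P :: "(real ^ 'n) ^ 'n option" where "\<forall>i. P $ i \<in> nball 0 2"
      "circumradius N (cfg_hull P) = 1" "diam N (cfg_hull P) \<le> 1 / jung_constant N"
      by (rule exists_cfg_jung) blast
    then have "P \<in> X" using d by (simp add: X_def)
    then show ?thesis by blast
  qed
  obtain P where P: "P \<in> X"
    "\<And>Q. Q \<in> X \<Longrightarrow> inradius N (cfg_hull P) \<le> inradius N (cfg_hull Q)"
    using continuous_attains_inf[OF co ne continuous_on_inradius] by blast
  obtain Q :: "(real ^ 'n) ^ 'n option" where Q: "circumradius N (cfg_hull Q) = 1"
    "diam N (cfg_hull Q) = d" "inradius N (cfg_hull Q) \<le> inradius N (cfg_hull P)"
    using cfg_enlarge_diam[OF n, of P d] P(1) d(2) by (auto simp: X_def)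
  show ?thesis
  proof (rule that[OF Q(1,2)])
    fix K assume K: "convex_body K" "circumradius N K = 1" "diam N K \<le> d"
    then obtain P' :: "(real ^ 'n) ^ 'n option" where P': "\<forall>i. P' $ i \<in> nball 0 2"
      "circumradius N (cfg_hull P') = 1" "diam N (cfg_hull P') \<le> diam N K"
      "inradius N (cfg_hull P') \<le> inradius N K"
      using body_to_cfg[OF K(1)] unfolding K(2) div_by_1 by (metis zero_less_one)
    then have "P' \<in> X" using K(3) by (simp add: X_def)
    then show "inradius N (cfg_hull Q) \<le> inradius N K" using P(2)[of P'] Q(3) P'(4) by simp
  qed
qed

lemma min_inradius_eq:
  assumes "convex_body S" "circumradius N S = 1" "diam N S = d"
    and "\<And>K. convex_body K \<Longrightarrow> circumradius N K = 1 \<Longrightarrow> diam N K \<le> d \<Longrightarrow>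
      inradius N S \<le> inradius N K"
  shows "min_inradius N d = inradius N S"
  unfolding min_inradius_def using assms by (intro cInf_eq_minimum) auto

end

theorem theorem1p3:
  fixes N :: "real ^ 'n \<Rightarrow> real"
  assumes "CARD('n) \<ge> 2"
    and "is_norm N"
  shows "(\<forall>D \<in> {1 / jung_constant N .. 2}.
            \<exists>S. convex_body S \<and>
                (aff_dim S \<le> int CARD('n) - 1 \<or> int CARD('n) simplex S) \<and>
                circumradius N S = 1 \<and> diam N S = D \<and>
                inradius N S = min_inradius N D)
       \<and> (\<forall>D\<^sub>1 D\<^sub>2. 1 / jung_constant N \<le> D\<^sub>1 \<and> D\<^sub>1 < D\<^sub>2 \<and> D\<^sub>2 \<le> 2
            \<longrightarrow> min_inradius N D\<^sub>2 \<le> min_inradius N D\<^sub>1)"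
proof -
  interpret minkowski N by unfold_locales (rule assms(2))
  \<comment> \<open>Minimality against all bodies of diameter at most \<open>d\<close>, not only
    equal to \<open>d\<close>, is recorded because it yields the monotonicity.\<close>
  have main: "\<exists>S. convex_body S \<and>
      (aff_dim S \<le> int CARD('n) - 1 \<or> int CARD('n) simplex S) \<and>
      circumradius N S = 1 \<and> diam N S = d \<and> inradius N S = min_inradius N d \<and>
      (\<forall>K. convex_body K \<longrightarrow> circumradius N K = 1 \<longrightarrow> diam N K \<le> d \<longrightarrow>
        inradius N S \<le> inradius N K)"
    if d: "1 / jung_constant N \<le> d" "d \<le> 2" for d
  proof -
    obtain Q :: "(real ^ 'n) ^ 'n option"
      where Q: "circumradius N (cfg_hull Q) = 1" "diam N (cfg_hull Q) = d"
        "\<And>K. convex_body K \<Longrightarrow> circumradius N K = 1 \<Longrightarrow> diam N K \<le> d \<Longrightarrow>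
          inradius N (cfg_hull Q) \<le> inradius N K"
      using exists_optimal_cfg[OF assms(1) d] by blast
    show ?thesis
      using Q cfg_hull_dichotomy[of Q] min_inradius_eq[OF convex_body_cfg_hull Q]
      by (intro exI[of _ "cfg_hull Q"]) (simp add: convex_body_cfg_hull)
  qed
  show ?thesis
  proof (intro conjI ballI allI impI)
    fix D assume "D \<in> {1 / jung_constant N .. 2}"
    then show "\<exists>S. convex_body S \<and>
        (aff_dim S \<le> int CARD('n) - 1 \<or> int CARD('n) simplex S) \<and>
        circumradius N S = 1 \<and> diam N S = D \<and> inradius N S = min_inradius N D"
      using main[of D] by auto
  next
    fix D\<^sub>1 D\<^sub>2 assume D: "1 / jung_constant N \<le> D\<^sub>1 \<and> D\<^sub>1 < D\<^sub>2 \<and> D\<^sub>2 \<le> 2"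
    obtain S\<^sub>1 where "convex_body S\<^sub>1" "circumradius N S\<^sub>1 = 1" "diam N S\<^sub>1 = D\<^sub>1"
      "inradius N S\<^sub>1 = min_inradius N D\<^sub>1"
      using main[of D\<^sub>1] D by auto
    moreover obtain S\<^sub>2 where "inradius N S\<^sub>2 = min_inradius N D\<^sub>2"
      "\<And>K. convex_body K \<Longrightarrow> circumradius N K = 1 \<Longrightarrow> diam N K \<le> D\<^sub>2 \<Longrightarrow>
        inradius N S\<^sub>2 \<le> inradius N K"
      using main[of D\<^sub>2] D by (metis less_le order.trans)
    \<comment> \<open>The first body has diameter below the second bound, so it competes with the
      second minimiser.\<close>
    ultimately show "min_inradius N D\<^sub>2 \<le> min_inradius N D\<^sub>1"
      using D by (metis less_imp_le)
  qed
qed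

end
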